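(* For real $x\geq 2$ let \[ S(\alpha)=\sum_{n\leq x}d(n)e(n\alpha),\qquad e(t)=e^{2\pi i t},\] where $d(n)$ denotes the number of positive divisors of $n$. Then \[ \int_0^1|S(\alpha)|\,d\alpha\asymp \sqrt{x},\] i.e. there are absolute constants $0<c_1<c_2$ such that $c_1\sqrt x\leq \int_0^1|S(\alpha)|\,d\alpha\leq c_2\sqrt x$ for all $x\geq 2$.
   Context: $d(n)=\sum_{m\mid n}1$ is the divisor function. *)

theory Defs
  imports "HOL-Analysis.Analysis"
begin

definition divisor_count :: "nat \<Rightarrow> nat" where
  "divisor_count n = card {m. m dvd n}"

definition expo :: "real \<Rightarrow> complex" where
  "expo t = exp (2 * of_real pi * \<i> * of_real t)"

definition S_div :: "real \<Rightarrow> real \<Rightarrow> complex" where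
  "S_div x \<alpha> = (\<Sum>n\<in>{1..nat \<lfloor>x\<rfloor>}. of_nat (divisor_count n) * expo (real n * \<alpha>))"

end

(*
Weighting a factorisation n = m k by k/(m + k) = n/(m^2 + n) gives d(n) = 2 sum_{m | n} n/(m^2 + n).
Expanding the condition m | n in additive characters and collecting reduced fractions a/q,
S(alpha) becomes 2 sum_q sum_a K_q(alpha + a/q), where K_q has the slowly increasing coefficients kap_q(n).

Upper bound: for q in [Q, 2Q) subtract from kap_q a ramp of length min(Q^2, N) ending at N.  What remains vanishes at
both ends and varies slowly, so a weighted L2 estimate bounds its L1 norm.  The ramps have the same
shape for all q in the block; their sum is bounded in L2 because they are dominated by Fejer
coefficients, and the Fejer kernels at the Farey fractions have a bounded sum by spacing.
The dyadic blocks add up to O(sqrt N) geometrically.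

Lower bound: S is tested against V = sum of Fejer kernels at the fractions a/q, q <= 2Y, with
weights floor(2Y/q) - 2 floor(Y/q) in {0, 1}, where Y is a small multiple of sqrt N.  Then
|V| <= 3 N^2, while the integral of S V is a combination of sums of d(n) over multiples of q and
is at least of order N^2 Y.
*)
theory Submission
  imports Defs "HOL-Number_Theory.Totient" "HOL-Library.Discrete_Functions"
begin

section \<open>Exponential sums on the unit interval\<close>

text \<open>The obstacle in the upper bound is the sharp end at N. For q <= sqrt N the coefficients
  of K_q near N are of order at least 1/q, so the jump there puts a factor log N into the L1 norm;
  adding these norms over all fractions would cost that factor. Hence the jumps are treated
  together, and only the remainders are summed by the triangle inequality. The usual restriction m
  <= sqrt n would make the coefficients jump at squares, whereas n/(m^2 + n) is smooth and
  increasing in n: the increments of kap_q are nonnegative, of size O(1/q^3), and they telescope.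
  The ramp length Q^2 fits twice: fractions of the block are spaced by about 1/Q^2, so Fejer kernels
  of that length add up without loss, and kap_q moves by only O(1/Q) over Q^2 steps. In the lower
  bound the error is of order Y^2 N^(3/2) against a main term of order N^2 Y, which is why Y has to
  be a small multiple of sqrt N.\<close>

lemma expo_add: "expo (a + b) = expo a * expo b"
  by (simp add: expo_def distrib_left exp_add)

lemma expo_0 [simp]: "expo 0 = 1"
  by (simp add: expo_def)

lemma expo_eq_cis: "expo t = cis (2 * pi * t)"
  by (simp add: expo_def cis_conv_exp mult_ac)

lemma norm_expo [simp]: "norm (expo t) = 1"
  by (simp add: expo_eq_cis)

lemma cnj_expo: "cnj (expo t) = expo (- t)"
  by (simp add: expo_eq_cis cis_cnj)

lemma expo_of_int [simp]: "expo (of_int k) = 1"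
  by (simp add: expo_eq_cis cis_multiple_2pi)

lemma expo_add_int [simp]: "expo (t + of_int k) = expo t"
  by (simp add: expo_add)

lemma expo_eq_if: "a - b = of_int k \<Longrightarrow> expo a = expo b"
  using expo_add_int[of b k] by (simp add: algebra_simps)

lemma expo_nat_mult: "expo (real n * t) = expo t ^ n"
  by (simp add: expo_eq_cis Complex.DeMoivre mult_ac)

lemma continuous_on_expo [continuous_intros]:
  "continuous_on A f \<Longrightarrow> continuous_on A (\<lambda>x. expo (f x))"
  unfolding expo_def by (intro continuous_intros)

lemma has_integral_expo:
  "((\<lambda>\<alpha>. expo (of_int h * \<alpha>)) has_integral (if h = 0 then 1 else 0)) {0..1}"
proof (cases "h = 0")
  case True
  then show ?thesis using has_integral_const_real[of "1::complex" 0 1] by simp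
next
  case False
  let ?c = "2 * of_real pi * \<i> * of_int h :: complex"
  have c: "?c \<noteq> 0" using False by simp
  have "((\<lambda>\<alpha>. expo (of_int h * \<alpha>)) has_integral
        (exp (?c * of_real 1) / ?c - exp (?c * of_real 0) / ?c)) {0..1}"
  proof (rule fundamental_theorem_of_calculus)
    fix x :: real assume "x \<in> {0..1}"
    have "((\<lambda>z. exp (?c * z) / ?c) has_field_derivative exp (?c * of_real x)) (at (of_real x))"
      using c by (auto intro!: derivative_eq_intros)
    then have "((\<lambda>t. exp (?c * of_real t) / ?c) has_vector_derivative exp (?c * of_real x)) (at x within {0..1})"
      by (rule has_vector_derivative_real_field)
    then show "((\<lambda>t. exp (?c * of_real t) / ?c) has_vector_derivative expo (of_int h * x)) (at x within {0..1})"
      by (simp add: expo_def mult_ac)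
  qed simp
  moreover have "exp ?c = 1"
    using expo_of_int[of h] by (simp add: expo_def mult_ac)
  ultimately show ?thesis using False by simp
qed

lemma parseval_int:
  fixes c :: "int \<Rightarrow> complex"
  assumes "finite A"
  shows "((\<lambda>\<alpha>. (norm (\<Sum>h\<in>A. c h * expo (of_int h * \<alpha>)))\<^sup>2) has_integral (\<Sum>h\<in>A. (norm (c h))\<^sup>2)) {0..1}"
proof -
  have "((\<lambda>\<alpha>. \<Sum>h\<in>A. \<Sum>k\<in>A. (c h * cnj (c k)) * expo (of_int (h - k) * \<alpha>)) has_integral
        (\<Sum>h\<in>A. \<Sum>k\<in>A. (c h * cnj (c k)) * (if h - k = 0 then 1 else 0))) {0..1}"
    by (intro has_integral_sum assms has_integral_mult_right has_integral_expo)
  moreover have "(\<Sum>h\<in>A. \<Sum>k\<in>A. (c h * cnj (c k)) * expo (of_int (h - k) * \<alpha>)) =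
      of_real ((norm (\<Sum>h\<in>A. c h * expo (of_int h * \<alpha>)))\<^sup>2)" for \<alpha>
  proof -
    have "expo (of_int (h - k) * \<alpha>) = expo (of_int h * \<alpha>) * cnj (expo (of_int k * \<alpha>))" for h k
      by (simp add: cnj_expo expo_add[symmetric] algebra_simps)
    then have "(\<Sum>h\<in>A. \<Sum>k\<in>A. (c h * cnj (c k)) * expo (of_int (h - k) * \<alpha>)) =
        (\<Sum>h\<in>A. \<Sum>k\<in>A. (c h * expo (of_int h * \<alpha>)) * cnj (c k * expo (of_int k * \<alpha>)))"
      by (intro sum.cong refl) (simp add: mult_ac)
    also have "\<dots> = of_real ((norm (\<Sum>h\<in>A. c h * expo (of_int h * \<alpha>)))\<^sup>2)"
      by (simp only: complex_norm_square sum_product cnj_sum)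
    finally show ?thesis .
  qed
  moreover have "(\<Sum>h\<in>A. \<Sum>k\<in>A. (c h * cnj (c k)) * (if h - k = 0 then 1 else 0)) =
      of_real (\<Sum>h\<in>A. (norm (c h))\<^sup>2)"
    using assms by (simp add: complex_norm_square[symmetric] if_distrib cong: if_cong)
  ultimately have "((\<lambda>\<alpha>. complex_of_real ((norm (\<Sum>h\<in>A. c h * expo (of_int h * \<alpha>)))\<^sup>2)) has_integral
      of_real (\<Sum>h\<in>A. (norm (c h))\<^sup>2)) {0..1}"
    by simp
  from has_integral_linear[OF this bounded_linear_Re] show ?thesis
    by (simp add: o_def)
qed

lemma parseval_nat:
  fixes c :: "nat \<Rightarrow> complex"
  assumes "finite A"
  shows "((\<lambda>\<alpha>. (norm (\<Sum>n\<in>A. c n * expo (real n * \<alpha>)))\<^sup>2) has_integral (\<Sum>n\<in>A. (norm (c n))\<^sup>2)) {0..1}"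
  using parseval_int[of "int ` A" "c \<circ> nat"] assms
  by (simp add: sum.reindex)

text \<open>Allows a kernel centred at a fraction to be moved to the centre 0 before its mean value
  is estimated. After reduction to the fractional part of the shift, the piece beyond 1 is carried
  back by one period.\<close>

lemma integral_periodic_shift:
  fixes f :: "real \<Rightarrow> real"
  assumes cont: "continuous_on UNIV f" and per: "\<And>t. f (t + 1) = f t"
  shows "integral {0..1} (\<lambda>t. f (t + x)) = integral {0..1} f"
proof -
  have c: "continuous_on S f" for S
    using cont continuous_on_subset by blast
  have sh: "integral {a..b} (\<lambda>t. f (t + d)) = integral {a+d..b+d} f" for a b d
    using integral_shift[of a d b f] c by (simp add: o_def)
  have perk: "f (t + of_int k) = f t" for t k
  proof -
    have n: "f (t + real n) = f t" for t n
      by (induction n arbitrary: t) (simp_all add: add.assoc[symmetric] per)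
    show ?thesis
      using n[of t "nat k"] n[of "t + of_int k" "nat (-k)"] by (cases "k \<ge> 0") auto
  qed
  define y where "y = frac x"
  have y: "0 \<le> y" "y < 1" by (auto simp: y_def frac_lt_1)
  have int: "f integrable_on {a..b}" for a b
    by (intro integrable_continuous_real c)
  have "f (t + x) = f (t + y)" for t
    using perk[of "t + y" "\<lfloor>x\<rfloor>"] by (simp add: y_def frac_def algebra_simps)
  then have "integral {0..1} (\<lambda>t. f (t + x)) = integral {y..1+y} f"
    by (simp add: sh)
  also have "\<dots> = integral {y..1} f + integral {1..1+y} f"
    using y Henstock_Kurzweil_Integration.integral_combine[OF _ _ int, of y 1 "1 + y"] by simp
  also have "integral {1..1+y} f = integral {0..y} f"
    using sh[of 0 y 1] per by (simp add: add.commute)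
  also have "integral {y..1} f + integral {0..y} f = integral {0..1} f"
    using y Henstock_Kurzweil_Integration.integral_combine[OF _ _ int, of 0 y 1] by simp
  finally show ?thesis .
qed

section \<open>The size of e(t) - 1 and the distance to the nearest integer\<close>

lemma sin_pi_ge:
  assumes "0 \<le> t" "t \<le> 1/2"
  shows "2 * t \<le> sin (pi * t)"
proof -
  have "concave_on {0..pi/2} sin"
    by (rule f''_le0_imp_concave[where f' = cos and f'' = "\<lambda>x. - sin x"])
      (auto intro!: derivative_eq_intros sin_ge_zero)
  from concave_onD[OF this, of "2*t" 0 "pi/2"] assms show ?thesis
    by (simp add: mult.commute)
qed

lemma norm_expo_diff: "norm (expo t - 1) = 2 * \<bar>sin (pi * t)\<bar>"
proof -
  have "(norm (expo t - 1))\<^sup>2 = (cos (2*(pi*t)) - 1)\<^sup>2 + (sin (2*(pi*t)))\<^sup>2"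
    by (simp add: expo_eq_cis cmod_power2 mult_ac)
  also have "\<dots> = 4 * (sin (pi * t))\<^sup>2 * ((sin (pi*t))\<^sup>2 + (cos (pi*t))\<^sup>2)"
    unfolding cos_double_sin sin_double by algebra
  also have "\<dots> = (2 * \<bar>sin (pi * t)\<bar>)\<^sup>2"
    unfolding sin_cos_squared_add by (simp add: power_mult_distrib)
  finally show ?thesis
    by (metis abs_ge_zero mult_nonneg_nonneg norm_ge_zero power2_eq_iff_nonneg zero_le_numeral)
qed

lemma norm_expo_diff_ge:
  assumes "0 \<le> t" "t \<le> 1"
  shows "4 * min t (1 - t) \<le> norm (expo t - 1)"
proof (cases "t \<le> 1/2")
  case True
  then show ?thesis using sin_pi_ge[of t] assms by (simp add: norm_expo_diff)
next
  case False
  have "sin (pi * (1 - t)) = sin (pi * t)"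
    by (simp add: right_diff_distrib)
  then show ?thesis using sin_pi_ge[of "1-t"] assms False by (simp add: norm_expo_diff)
qed

text \<open>Since |e(t) - 1| is at least 4 times the distance u from t to the nearest integer, each
  half of the interval is dominated by 1 / (1 + (4Tu)^2), whose integral is arctan(2T) / (4T). With
  arctan < pi/2 and pi < 4 this is at most 1 / (2T) per half.\<close>

lemma integral_expo_weight_le:
  assumes T: "T > 0"
  shows "integral {0..1} (\<lambda>t. 1 / (1 + T\<^sup>2 * (norm (expo t - 1))\<^sup>2)) \<le> 1 / T"
proof -
  let ?w = "\<lambda>t. 1 / (1 + T\<^sup>2 * (norm (expo t - 1))\<^sup>2)"
  let ?A = "\<lambda>t. arctan (4 * T * t) / (4 * T)"
  have pos: "1 + T\<^sup>2 * u\<^sup>2 \<noteq> 0" for u :: real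
    using zero_le_power2[of "T * u"] by (simp add: power_mult_distrib add_nonneg_eq_0_iff)
  have cont: "continuous_on S ?w" for S
    by (intro continuous_intros ballI pos)
  have at: "?A (1/2) \<le> 1 / (2 * T)"
    using arctan_ubound[of "4 * T * (1/2)"] pi_less_4 T by (simp add: field_simps)
  have D: "(?A has_real_derivative 1 / (1 + (4*T*t)\<^sup>2)) (at t within S)" for t S
    using T by (auto intro!: derivative_eq_intros simp: inverse_eq_divide)
  have D': "((\<lambda>t. - ?A (1 - t)) has_real_derivative 1 / (1 + (4*T*(1-t))\<^sup>2)) (at t within S)" for t S
    by (rule derivative_eq_intros DERIV_chain2[OF D] refl | simp)+
  have A: "((\<lambda>t. 1 / (1 + (4*T*t)\<^sup>2)) has_integral (?A b - ?A a)) {a..b}" if "a \<le> b" for a b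
    using that D
    by (intro fundamental_theorem_of_calculus)
      (auto simp: has_real_derivative_iff_has_vector_derivative[symmetric])
  have B: "((\<lambda>t. 1 / (1 + (4*T*(1-t))\<^sup>2)) has_integral (- ?A (1-b) - (- ?A (1-a)))) {a..b}" if "a \<le> b" for a b
    using that D'
    by (intro fundamental_theorem_of_calculus)
      (auto simp: has_real_derivative_iff_has_vector_derivative[symmetric])
  have le: "?w t \<le> 1 / (1 + (4*T*u)\<^sup>2)" if "0 \<le> u" "4 * u \<le> norm (expo t - 1)" for t u
  proof -
    have "(4 * T * u)\<^sup>2 = T\<^sup>2 * (4 * u)\<^sup>2" by (simp add: power_mult_distrib)
    also have "\<dots> \<le> T\<^sup>2 * (norm (expo t - 1))\<^sup>2"
      using that by (intro mult_left_mono power_mono) auto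
    finally show ?thesis
      by (intro divide_left_mono) (auto intro!: mult_pos_pos add_pos_nonneg)
  qed
  have "integral {0..1} ?w = integral {0..1/2} ?w + integral {1/2..1} ?w"
    by (intro Henstock_Kurzweil_Integration.integral_combine[symmetric] integrable_continuous_real cont) auto
  also have "integral {0..1/2} ?w \<le> ?A (1/2) - ?A 0"
    by (rule has_integral_le[OF integrable_integral[OF integrable_continuous_real[OF cont]] A])
      (auto intro!: le simp: norm_expo_diff_ge[THEN order_trans[rotated]] min_def intro: order_trans[OF _ norm_expo_diff_ge])
  also have "integral {1/2..1} ?w \<le> - ?A (1-1) - (- ?A (1-1/2))"
    by (rule has_integral_le[OF integrable_integral[OF integrable_continuous_real[OF cont]] B])
      (auto intro!: le intro: order_trans[OF _ norm_expo_diff_ge] simp: min_def)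
  finally show ?thesis using at by (simp add: field_simps)
qed

section \<open>The Fejer kernel at Farey fractions\<close>

text \<open>This is H times the usual Fejer kernel: the coefficient of e(hb) is H - |h|, and
  integers b give the maximum H^2. The squared modulus makes nonnegativity immediate.\<close>

definition fejer :: "nat \<Rightarrow> real \<Rightarrow> real" where
  "fejer H b = (norm (\<Sum>n<H. expo (real n * b)))\<^sup>2"

lemma fejer_nonneg: "0 \<le> fejer H b"
  by (simp add: fejer_def)

text \<open>Passing from H to H + 1 adds one exponential: its cross terms with the old sum are the
  frequencies 0 < h <= H and -H <= h < 0, its square is h = 0. Every coefficient with |h| <= H thus
  grows by one.\<close>

lemma fejer_expand:
  "complex_of_real (fejer H b) =
    (\<Sum>h\<in>{- int H<..<int H}. of_int (int H - \<bar>h\<bar>) * expo (of_int h * b))"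
proof (induction H)
  case 0
  then show ?case by (simp add: fejer_def)
next
  case (Suc H)
  let ?D = "\<Sum>n<H. expo (real n * b)" and ?z = "expo (real H * b)"
  have up: "?z * cnj ?D = (\<Sum>h\<in>{0<..int H}. expo (of_int h * b))"
    unfolding cnj_sum sum_distrib_left
    by (rule sum.reindex_bij_witness[of _ "\<lambda>h. nat (int H - h)" "\<lambda>n. int H - int n"])
      (auto simp: cnj_expo expo_add[symmetric] of_nat_diff algebra_simps)
  have down: "?D * cnj ?z = (\<Sum>h\<in>{- int H..<0}. expo (of_int h * b))"
    unfolding sum_distrib_right
    by (rule sum.reindex_bij_witness[of _ "\<lambda>h. nat (int H + h)" "\<lambda>n. int n - int H"])
      (auto simp: cnj_expo expo_add[symmetric] of_nat_diff algebra_simps)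
  have all: "{- int H..int H} = insert 0 ({- int H..<0} \<union> {0<..int H})" by auto
  have "complex_of_real (fejer (Suc H) b) = (?D + ?z) * cnj (?D + ?z)"
    by (simp only: fejer_def complex_norm_square sum.lessThan_Suc)
  also have "\<dots> = ?D * cnj ?D + ?D * cnj ?z + ?z * cnj ?D + ?z * cnj ?z"
    by (simp only: complex_cnj_add distrib_left distrib_right add.assoc add.left_commute)
  also have "?D * cnj ?D = complex_of_real (fejer H b)"
    by (simp only: fejer_def complex_norm_square)
  also have "?z * cnj ?z = 1"
    by (simp add: complex_norm_square[symmetric])
  also have "complex_of_real (fejer H b) + ?D * cnj ?z + ?z * cnj ?D + 1 =
     complex_of_real (fejer H b) + (\<Sum>h\<in>{- int H..int H}. expo (of_int h * b))"
    unfolding up down all by (subst sum.insert, simp, simp, subst sum.union_disjoint) auto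
  also have "complex_of_real (fejer H b) = (\<Sum>h\<in>{- int H..int H}. of_int (int H - \<bar>h\<bar>) * expo (of_int h * b))"
    unfolding Suc.IH by (rule sum.mono_neutral_left) auto
  also have "\<dots> + (\<Sum>h\<in>{- int H..int H}. expo (of_int h * b)) =
      (\<Sum>h\<in>{- int H..int H}. of_int (int (Suc H) - \<bar>h\<bar>) * expo (of_int h * b))"
    unfolding sum.distrib[symmetric] by (intro sum.cong refl) (simp add: algebra_simps)
  also have "{- int H..int H} = {- int (Suc H)<..<int (Suc H)}" by auto
  finally show ?case .
qed

lemma fejer_le_square: "fejer H b \<le> (real H)\<^sup>2"
proof -
  have "norm (\<Sum>n<H. expo (real n * b)) \<le> real H"
    using norm_sum[of "\<lambda>n. expo (real n * b)" "{..<H}"] by simp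
  then show ?thesis unfolding fejer_def by (intro power_mono) auto
qed

lemma fejer_add_int: "fejer H (b + of_int k) = fejer H b"
proof -
  have "expo (real n * (b + of_int k)) = expo (real n * b)" for n
    by (rule expo_eq_if[of _ _ "int n * k"]) (simp add: algebra_simps)
  then show ?thesis by (simp add: fejer_def)
qed

text \<open>The geometric sum is at most 2 / |e(t) - 1|. Any u below the distances to both 0 and 1
  will do, so a caller need not know which endpoint is nearer.\<close>

lemma fejer_decay:
  assumes "0 < u" "u \<le> t" "u \<le> 1 - t"
  shows "fejer H t \<le> 1 / (4 * u\<^sup>2)"
proof -
  let ?D = "\<Sum>n<H. expo (real n * t)"
  have "4 * u \<le> 4 * min t (1 - t)" using assms by simp
  also have "\<dots> \<le> norm (expo t - 1)"
    using assms by (intro norm_expo_diff_ge) auto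
  finally have "norm ?D * (4 * u) \<le> norm ?D * norm (expo t - 1)"
    by (intro mult_left_mono) auto
  also have "\<dots> = norm (?D * (expo t - 1))" by (simp add: norm_mult)
  also have "?D * (expo t - 1) = expo (real H * t) - 1"
    unfolding expo_nat_mult by (subst mult.commute) (rule power_diff_1_eq[symmetric])
  also have "norm \<dots> \<le> 2"
    using norm_triangle_ineq4[of "expo (real H * t)" 1] by simp
  finally have "norm ?D \<le> 1 / (2 * u)"
    using assms by (simp add: field_simps)
  then have "fejer H t \<le> (1 / (2 * u))\<^sup>2"
    unfolding fejer_def by (intro power_mono) auto
  then show ?thesis by (simp add: power_divide power_mult_distrib)
qed

lemma sum_inverse_squares_le: "(\<Sum>k<n. 1 / (real k)\<^sup>2) \<le> 2"
proof -
  \<comment> \<open>The sharper bound closes the induction, as 1/(n+1)^2 <= 1/n - 1/(n+1). The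
    summand k = 0 and the bound for n = 0 rely on 1/0 = 0.\<close>
  have "(\<Sum>k<Suc n. 1 / (real k)\<^sup>2) \<le> 2 - 1 / real n" for n
  proof (induction n)
    case (Suc n)
    show ?case
    proof (cases "n = 0")
      case False
      then have "1 / (real (Suc n))\<^sup>2 \<le> 1 / real n - 1 / real (Suc n)"
        by (simp add: divide_simps) (simp add: power2_eq_square algebra_simps)
      with Suc show ?thesis by simp
    qed simp
  qed simp
  from this[of n] show ?thesis
    by simp (smt (verit) divide_nonneg_nonneg of_nat_0_le_iff zero_le_power2)
qed

text \<open>Residues run from 0 to q - 1, so q = 1 contributes the fraction 0/1 and every fraction
  in [0, 1) is represented exactly once.\<close>

definition reduced_residues :: "nat \<Rightarrow> nat set" where
  "reduced_residues q = {a. a < q \<and> coprime a q}"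

lemma finite_reduced [simp, intro]: "finite (reduced_residues q)"
  by (simp add: reduced_residues_def)

lemma card_reduced_le: "card (reduced_residues q) \<le> q"
  using card_mono[of "{..<q}" "reduced_residues q"] by (auto simp: reduced_residues_def)

lemma reduced_fraction_unique:
  assumes "a \<in> reduced_residues q" "a' \<in> reduced_residues q'" "real a / real q = real a' / real q'"
  shows "q = q' \<and> a = a'"
proof -
  have pos: "q > 0" "q' > 0" using assms by (auto simp: reduced_residues_def)
  with assms(3) have eq: "a * q' = a' * q"
    by (simp add: field_simps flip: of_nat_mult)
  have "q dvd q'" using eq assms
    by (metis coprime_commute coprime_dvd_mult_right_iff dvd_triv_right mem_Collect_eq reduced_residues_def)
  moreover have "q' dvd q" using eq assms
    by (metis coprime_commute coprime_dvd_mult_right_iff dvd_triv_right mem_Collect_eq reduced_residues_def)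
  ultimately show ?thesis using eq pos by (auto dest: dvd_antisym)
qed

text \<open>Reduction of l/m to lowest terms; the inverse map multiplies a by m/q. It serves to
  split a complete sum modulo m into reduced fractions, and also to reassemble one.\<close>

lemma sum_fractions:
  assumes "m > 0"
  shows "(\<Sum>l<m. f (real l / real m)) = (\<Sum>q | q dvd m. \<Sum>a\<in>reduced_residues q. f (real a / real q))"
proof -
  have "(\<Sum>l<m. f (real l / real m)) =
     (\<Sum>(q, a)\<in>(SIGMA q:{q. q dvd m}. reduced_residues q). f (real a / real q))"
  proof (rule sum.reindex_bij_witness[of _ "\<lambda>(q, a). a * (m div q)" "\<lambda>l. (m div gcd l m, l div gcd l m)"])
    fix l assume l: "l \<in> {..<m}"
    have g: "gcd l m > 0" using assms by simp
    then have "l div gcd l m < m div gcd l m"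
      using l by (intro div_less_mono) auto
    moreover have "coprime (l div gcd l m) (m div gcd l m)"
      using assms by (intro div_gcd_coprime) auto
    ultimately show "(m div gcd l m, l div gcd l m) \<in> (SIGMA q:{q. q dvd m}. reduced_residues q)"
      using l by (auto simp: reduced_residues_def div_dvd_iff_mult)
    show "(case (m div gcd l m, l div gcd l m) of (q, a) \<Rightarrow> a * (m div q)) = l"
      using assms by (simp add: div_div_eq_right)
    show "(case (m div gcd l m, l div gcd l m) of (q, a) \<Rightarrow> f (real a / real q)) = f (real l / real m)"
      using g by (simp add: real_of_nat_div)
  next
    fix p assume "p \<in> (SIGMA q:{q. q dvd m}. reduced_residues q)"
    then obtain q a where p: "p = (q, a)" "q dvd m" "a < q" "coprime a q"
      by (auto simp: reduced_residues_def)
    then obtain r where r: "m = q * r" by blast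
    have pos: "q > 0" "r > 0" using assms r by auto
    have g: "gcd (a * r) m = r"
      using p r by (simp add: gcd_mult_distrib_nat[symmetric] mult.commute[of _ r])
    show "(m div gcd (case p of (q, a) \<Rightarrow> a * (m div q)) m, (case p of (q, a) \<Rightarrow> a * (m div q)) div gcd (case p of (q, a) \<Rightarrow> a * (m div q)) m) = p"
      using p r pos g by simp
    show "(case p of (q, a) \<Rightarrow> a * (m div q)) \<in> {..<m}"
      using p r pos by simp
  qed
  also have "\<dots> = (\<Sum>q | q dvd m. \<Sum>a\<in>reduced_residues q. f (real a / real q))"
    using assms by (subst sum.Sigma) auto
  finally show ?thesis .
qed

text \<open>Fractions with denominators at most R are at least 1/R^2 apart modulo 1, so each of the
  n = R^2 cells [k/n, (k+1)/n) holds at most one shifted point. The two cells next to an integer get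
  the trivial bound H^2, the others the decay bound; n <= H turns 2 H^2 + n^2 into 3 H^2.\<close>

lemma sum_fejer_farey_le:
  assumes R: "1 \<le> R" "R\<^sup>2 \<le> H"
  shows "(\<Sum>(q, a)\<in>(SIGMA q:{1..R}. reduced_residues q). fejer H (\<alpha> + real a / real q)) \<le> 3 * (real H)\<^sup>2"
proof -
  define n where "n = R\<^sup>2"
  define F where "F = (SIGMA q:{1..R}. reduced_residues q)"
  define y where "y = (\<lambda>(q, a). frac (\<alpha> + real a / real q))"
  define k where "k = (\<lambda>p. nat \<lfloor>real n * y p\<rfloor>)"
  \<comment> \<open>At \<open>k = 0\<close> and \<open>k = n - 1\<close> the quotients below are the harmless \<open>1 / 0 = 0\<close>.\<close>
  define g where "g = (\<lambda>k. (if k = 0 then (real H)\<^sup>2 else 0) + (if k = n - 1 then (real H)\<^sup>2 else 0) +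
      (real n)\<^sup>2 / 4 * (1 / (real k)\<^sup>2) + (real n)\<^sup>2 / 4 * (1 / (real (n - Suc k))\<^sup>2))"
  have n: "n \<ge> 1" using R by (simp add: n_def)
  have finF: "finite F" by (auto simp: F_def)
  have y01: "0 \<le> y p" "y p < 1" for p by (auto simp: y_def frac_lt_1 split: prod.split)
  have k_floor: "real (k p) = of_int \<lfloor>real n * y p\<rfloor>" for p
    unfolding k_def using y01(1)[of p] by (intro of_nat_nat) simp
  have kle: "real (k p) \<le> real n * y p" for p
    unfolding k_floor by (rule of_int_floor_le)
  have kgt: "real n * y p < real (k p) + 1" for p
    unfolding k_floor by (rule floor_correct[THEN conjunct2, simplified])
  have kn: "k p < n" for p
  proof -
    have "real n * y p < real n * 1"
      using y01(2)[of p] n by (intro mult_strict_left_mono) auto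
    then have "real (k p) < real n" using kle[of p] by linarith
    then show ?thesis by simp
  qed
  have inj: "inj_on k F"
  proof (rule inj_onI)
    fix p p' assume p: "p \<in> F" "p' \<in> F" "k p = k p'"
    obtain q a q' a' where eq: "p = (q, a)" "p' = (q', a')" by fastforce
    have q: "1 \<le> q" "q \<le> R" "a \<in> reduced_residues q" "1 \<le> q'" "q' \<le> R" "a' \<in> reduced_residues q'"
      using p eq by (auto simp: F_def)
    have "\<bar>real n * y p - real n * y p'\<bar> < 1"
      using kle[of p] kgt[of p] kle[of p'] kgt[of p'] p by linarith
    then have d: "real n * \<bar>y p - y p'\<bar> < 1"
      by (simp add: abs_mult right_diff_distrib[symmetric])
    obtain z :: int where z: "y p - y p' = real a / real q - real a' / real q' + of_int z"
    proof
      show "y p - y p' = real a / real q - real a' / real q' +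
          of_int (\<lfloor>\<alpha> + real a' / real q'\<rfloor> - \<lfloor>\<alpha> + real a / real q\<rfloor>)"
        by (simp add: y_def eq frac_def)
    qed
    \<comment> \<open>\<open>w\<close> is the numerator of \<open>y p - y p'\<close> over the common
      denominator q q' <= n. Points of one cell differ by less than 1/n, so this integer has
      absolute value below 1.\<close>
    define w where "w = int a * int q' - int a' * int q + z * int q * int q'"
    have w: "(y p - y p') * (real q * real q') = of_int w"
      unfolding z w_def using q by (simp add: field_simps)
    have "\<bar>real_of_int w\<bar> = (real q * real q') * \<bar>y p - y p'\<bar>"
      unfolding w[symmetric] by (simp add: abs_mult)
    also have "\<dots> \<le> real n * \<bar>y p - y p'\<bar>"
      unfolding n_def power2_eq_square of_nat_mult using q by (intro mult_right_mono mult_mono) auto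
    finally have "w = 0" using d by linarith
    then have "y p - y p' = 0" using w q by auto
    then have "real a / real q - real a' / real q' = of_int (- z)" using z by simp
    moreover have "\<bar>real a / real q - real a' / real q'\<bar> < 1"
    proof -
      have "0 \<le> real a / real q" "real a / real q < 1" "0 \<le> real a' / real q'" "real a' / real q' < 1"
        using q by (auto simp: reduced_residues_def)
      then show ?thesis by linarith
    qed
    ultimately have "real a / real q = real a' / real q'"
      by (cases "z = 0") auto
    then show "p = p'" using reduced_fraction_unique q eq by blast
  qed
  have bound: "fejer H (\<alpha> + real a / real q) \<le> g (k (q, a))" for q a
  proof -
    let ?p = "(q, a)"
    have fr: "fejer H (\<alpha> + real a / real q) = fejer H (y ?p)"
      using fejer_add_int[of H "y ?p" "\<lfloor>\<alpha> + real a / real q\<rfloor>"] by (simp add: y_def frac_def)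
    have nn: "0 \<le> (real n)\<^sup>2 / 4 * (1 / (real j)\<^sup>2)" for j by simp
    consider "k ?p = 0 \<or> k ?p = n - 1" | "k ?p > 0" "k ?p < n - 1" using kn[of ?p] by linarith
    then show ?thesis
    proof cases
      case 1
      then have "(real H)\<^sup>2 \<le> g (k ?p)"
        unfolding g_def using nn[of "k ?p"] nn[of "n - Suc (k ?p)"] by auto
      then show ?thesis
        using fejer_le_square by (rule order_trans[rotated])
    next
      case 2
      let ?k = "k ?p" and ?k' = "n - Suc (k ?p)"
      have k': "real ?k' = real n - 1 - real ?k" "?k' > 0" using 2 by auto
      \<comment> \<open>\<open>y (q, a)\<close> lies in the cell from k/n to (k+1)/n, hence at
        distance at least k/n from 0 and (n - 1 - k)/n from 1.\<close>
      define u where "u = min (real ?k / real n) (real ?k' / real n)"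
      have "0 < u" using 2 k' n by (simp add: u_def)
      moreover have "u \<le> y ?p" unfolding u_def using kle[of ?p] n
        by (intro min.coboundedI1) (simp add: field_simps)
      moreover have "u \<le> 1 - y ?p" unfolding u_def using kgt[of ?p] n k'
        by (intro min.coboundedI2) (simp add: field_simps)
      ultimately have "fejer H (y ?p) \<le> 1 / (4 * u\<^sup>2)" by (rule fejer_decay)
      also have "\<dots> \<le> (real n)\<^sup>2 / 4 * (1 / (real ?k)\<^sup>2) + (real n)\<^sup>2 / 4 * (1 / (real ?k')\<^sup>2)"
        unfolding u_def min_def using nn[of ?k] nn[of ?k'] by (auto simp: power_divide)
      also have "\<dots> \<le> g ?k" by (simp add: g_def)
      finally show ?thesis using fr by simp
    qed
  qed
  have "(\<Sum>(q, a)\<in>F. fejer H (\<alpha> + real a / real q)) \<le> (\<Sum>p\<in>F. g (k p))"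
    using bound by (intro sum_mono) auto
  also have "\<dots> = sum g (k ` F)" using inj by (simp add: sum.reindex)
  also have "\<dots> \<le> sum g {..<n}"
    using kn by (intro sum_mono2) (auto simp: g_def)
  also have "\<dots> = 2 * (real H)\<^sup>2 + (real n)\<^sup>2 / 4 * (\<Sum>k<n. 1 / (real k)\<^sup>2) +
      (real n)\<^sup>2 / 4 * (\<Sum>k<n. 1 / (real (n - Suc k))\<^sup>2)"
    using n unfolding g_def by (simp add: sum.distrib sum_distrib_left)
  also have "(\<Sum>k<n. 1 / (real (n - Suc k))\<^sup>2) = (\<Sum>k<n. 1 / (real k)\<^sup>2)"
    by (rule sum.nat_diff_reindex)
  also have "2 * (real H)\<^sup>2 + (real n)\<^sup>2 / 4 * (\<Sum>k<n. 1 / (real k)\<^sup>2) + (real n)\<^sup>2 / 4 * (\<Sum>k<n. 1 / (real k)\<^sup>2)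
      \<le> 2 * (real H)\<^sup>2 + (real n)\<^sup>2 / 4 * 2 + (real n)\<^sup>2 / 4 * 2"
    by (intro add_mono mult_left_mono sum_inverse_squares_le) auto
  also have "\<dots> \<le> 3 * (real H)\<^sup>2"
    using power_mono[of "real n" "real H" 2] R by (simp add: n_def flip: of_nat_power)
  finally show ?thesis by (simp add: F_def)
qed

section \<open>Mean values of smooth and sharply cut sums\<close>

text \<open>The pointwise AM-GM inequality |f| <= (|f|^2 / c + c) / 2 takes the place of
  Cauchy-Schwarz; with c the target bound, each half integrates to at most c/2.\<close>

lemma integral_norm_le_of_L2:
  fixes f :: "real \<Rightarrow> complex"
  assumes cont: "continuous_on {0..1} f" and I: "((\<lambda>\<alpha>. (norm (f \<alpha>))\<^sup>2) has_integral I) {0..1}"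
    and le: "I \<le> c\<^sup>2" and c: "c > 0"
  shows "integral {0..1} (\<lambda>\<alpha>. norm (f \<alpha>)) \<le> c"
proof -
  have "integral {0..1} (\<lambda>\<alpha>. norm (f \<alpha>)) \<le> (I / c + c) / 2"
  proof (rule has_integral_le)
    show "((\<lambda>\<alpha>. norm (f \<alpha>)) has_integral integral {0..1} (\<lambda>\<alpha>. norm (f \<alpha>))) {0..1}"
      by (intro integrable_integral integrable_continuous_real continuous_intros cont)
    have "((\<lambda>\<alpha>::real. c) has_integral c) {0..1}"
      using has_integral_const_real[of c 0 1] by simp
    then show "((\<lambda>\<alpha>. ((norm (f \<alpha>))\<^sup>2 / c + c) / 2) has_integral (I / c + c) / 2) {0..1}"
      by (intro has_integral_divide has_integral_add I)
    show "norm (f \<alpha>) \<le> ((norm (f \<alpha>))\<^sup>2 / c + c) / 2" for \<alpha>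
      using zero_le_power2[of "norm (f \<alpha>) - c"] c
      by (simp add: field_simps power2_eq_square)
  qed
  also have "\<dots> \<le> (c\<^sup>2 / c + c) / 2"
    using le c by (intro divide_right_mono add_mono) auto
  also have "\<dots> = c" using c by (simp add: power2_eq_square)
  finally show ?thesis .
qed

text \<open>Summation by parts: multiplication by e(t) - 1 differences the coefficients. The
  vanishing of \<open>v\<close> at both ends removes the boundary terms, which is why the value at N
  has to be subtracted as a ramp beforehand.\<close>

lemma sum_diff_mult_expo:
  fixes v :: "nat \<Rightarrow> complex"
  assumes "v 0 = 0" "v N = 0"
  shows "(\<Sum>n\<in>{1..N}. v n * expo (real n * t)) * (expo t - 1) =
    (\<Sum>n\<in>{1..N}. (v (n - 1) - v n) * expo (real n * t))"
proof -
  have "(\<Sum>n\<in>{1..m}. v n * expo (real n * t)) * (expo t - 1) =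
    (\<Sum>n\<in>{1..m}. (v (n - 1) - v n) * expo (real n * t)) + v m * expo (real (Suc m) * t)" for m
  proof (induction m)
    case (Suc m)
    have "expo (real (Suc (Suc m)) * t) = expo (real (Suc m) * t) * expo t"
      by (simp add: expo_add[symmetric] algebra_simps)
    with Suc show ?case by (simp add: algebra_simps)
  qed (use assms in simp)
  from this[of N] show ?thesis using assms by simp
qed

text \<open>Weighted AM-GM with weight $1 + T^2|e(t) - 1|^2$, where $T^2 = NM$ balances the two
Parseval sums.\<close>

lemma integral_norm_smooth_le:
  fixes v :: "nat \<Rightarrow> real"
  assumes v: "v 0 = 0" "v N = 0" and k: "k > 0" "\<And>n. n \<le> N \<Longrightarrow> \<bar>v n\<bar> \<le> k"
    and M: "M > 0" and N: "N > 0" and dv: "(\<Sum>n\<in>{1..N}. (v n - v (n - 1))\<^sup>2) \<le> 4 * k\<^sup>2 / M"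
  shows "integral {0..1} (\<lambda>\<alpha>. norm (\<Sum>n\<in>{1..N}. of_real (v n) * expo (real n * (\<alpha> + x))))
     \<le> 3 * k * sqrt (sqrt (real N / M))"
proof -
  define K where "K = (\<lambda>\<alpha>. \<Sum>n\<in>{1..N}. of_real (v n) * expo (real n * \<alpha>))"
  define T where "T = sqrt (real N * M)"
  \<comment> \<open>\<open>l\<close> is the AM-GM parameter. It makes both halves, A / l with A <= 5
    N k^2 and l / T, of order k sqrt(N / T); the 3 of the conclusion is (5 + 1) / 2.\<close>
  define l where "l = k * sqrt (real N) * sqrt T"
  define w where "w = (\<lambda>\<alpha>. 1 + T\<^sup>2 * (norm (expo \<alpha> - 1))\<^sup>2)"
  have T: "T > 0" "T\<^sup>2 = real N * M" using M N by (auto simp: T_def)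
  have l: "l > 0" using k N T by (simp add: l_def)
  have contK: "continuous_on A K" for A unfolding K_def by (intro continuous_intros)
  have w1: "w \<alpha> \<ge> 1" for \<alpha> by (simp add: w_def)
  have w0: "w \<alpha> \<noteq> 0" for \<alpha> using w1[of \<alpha>] by linarith
  have contw: "continuous_on A (\<lambda>\<alpha>. 1 / w \<alpha>)" for A
    using w0 unfolding w_def by (intro continuous_intros) auto
  have "integral {0..1} (\<lambda>\<alpha>. norm (K (\<alpha> + x))) = integral {0..1} (\<lambda>\<alpha>. norm (K \<alpha>))"
  proof (rule integral_periodic_shift)
    show "norm (K (t + 1)) = norm (K t)" for t
    proof -
      have "expo (real n * (t + 1)) = expo (real n * t)" for n
        by (rule expo_eq_if[of _ _ "int n"]) (simp add: algebra_simps)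
      then show ?thesis by (simp add: K_def)
    qed
  qed (intro continuous_intros contK)
  also have "\<dots> \<le> (5 * real N * k\<^sup>2 / l + l / T) / 2"
  proof -
    have "((\<lambda>\<alpha>. (norm (K \<alpha>))\<^sup>2) has_integral (\<Sum>n\<in>{1..N}. (norm (complex_of_real (v n)))\<^sup>2)) {0..1}"
      unfolding K_def by (rule parseval_nat) simp
    moreover have "((\<lambda>\<alpha>. (norm (K \<alpha> * (expo \<alpha> - 1)))\<^sup>2) has_integral
        (\<Sum>n\<in>{1..N}. (norm (complex_of_real (v (n - 1)) - of_real (v n)))\<^sup>2)) {0..1}"
      unfolding K_def using v by (subst sum_diff_mult_expo) (auto intro!: parseval_nat simp del: One_nat_def)
    ultimately have "((\<lambda>\<alpha>. (norm (K \<alpha>))\<^sup>2 + T\<^sup>2 * (norm (K \<alpha> * (expo \<alpha> - 1)))\<^sup>2) has_integral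
        ((\<Sum>n\<in>{1..N}. (norm (complex_of_real (v n)))\<^sup>2) +
          T\<^sup>2 * (\<Sum>n\<in>{1..N}. (norm (complex_of_real (v (n - 1)) - of_real (v n)))\<^sup>2))) {0..1}"
      by (intro has_integral_add has_integral_mult_right)
    also have "(\<lambda>\<alpha>. (norm (K \<alpha>))\<^sup>2 + T\<^sup>2 * (norm (K \<alpha> * (expo \<alpha> - 1)))\<^sup>2) = (\<lambda>\<alpha>. (norm (K \<alpha>))\<^sup>2 * w \<alpha>)"
      by (simp add: w_def norm_mult power_mult_distrib distrib_left mult_ac)
    finally obtain A where A: "((\<lambda>\<alpha>. (norm (K \<alpha>))\<^sup>2 * w \<alpha>) has_integral A) {0..1}"
      and A_eq: "A = (\<Sum>n\<in>{1..N}. (v n)\<^sup>2) + T\<^sup>2 * (\<Sum>n\<in>{1..N}. (v n - v (n - 1))\<^sup>2)"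
      by (simp add: norm_of_real power2_commute flip: of_real_diff)
    have "(v n)\<^sup>2 \<le> k\<^sup>2" if "n \<in> {1..N}" for n
      using k(2)[of n] that by (simp add: abs_le_square_iff[symmetric])
    then have "(\<Sum>n\<in>{1..N}. (v n)\<^sup>2) \<le> real N * k\<^sup>2"
      using sum_bounded_above[of "{1..N}" "\<lambda>n. (v n)\<^sup>2" "k\<^sup>2"] by simp
    moreover have "T\<^sup>2 * (\<Sum>n\<in>{1..N}. (v n - v (n - 1))\<^sup>2) \<le> T\<^sup>2 * (4 * k\<^sup>2 / M)"
      by (intro mult_left_mono dv) auto
    ultimately have A_le: "A \<le> 5 * real N * k\<^sup>2"
      unfolding A_eq T(2) using M by (simp add: field_simps)
    have "integral {0..1} (\<lambda>\<alpha>. norm (K \<alpha>)) \<le> (A / l + l * integral {0..1} (\<lambda>\<alpha>. 1 / w \<alpha>)) / 2"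
    proof (rule has_integral_le)
      show "((\<lambda>\<alpha>. norm (K \<alpha>)) has_integral integral {0..1} (\<lambda>\<alpha>. norm (K \<alpha>))) {0..1}"
        by (intro integrable_integral integrable_continuous_real continuous_intros contK)
      show "((\<lambda>\<alpha>. ((norm (K \<alpha>))\<^sup>2 * w \<alpha> / l + l * (1 / w \<alpha>)) / 2) has_integral
          (A / l + l * integral {0..1} (\<lambda>\<alpha>. 1 / w \<alpha>)) / 2) {0..1}"
        by (intro has_integral_divide has_integral_add A has_integral_mult_right integrable_integral
            integrable_continuous_real contw)
      show "norm (K \<alpha>) \<le> ((norm (K \<alpha>))\<^sup>2 * w \<alpha> / l + l * (1 / w \<alpha>)) / 2" for \<alpha>
        using zero_le_power2[of "norm (K \<alpha>) * w \<alpha> - l"] l w1[of \<alpha>]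
        by (simp add: field_simps power2_eq_square)
    qed
    also have "\<dots> \<le> (5 * real N * k\<^sup>2 / l + l * (1 / T)) / 2"
      unfolding w_def using l A_le T
      by (intro divide_right_mono add_mono mult_left_mono integral_expo_weight_le) auto
    finally show ?thesis by simp
  qed
  also have "\<dots> = 3 * k * (sqrt (real N) / sqrt T)"
  proof -
    have "5 * real N * k\<^sup>2 / l = 5 * k * (sqrt (real N) / sqrt T)"
      using k N T unfolding l_def by (simp add: field_simps power2_eq_square)
    moreover have "l / T = k * (sqrt (real N) / sqrt T)"
      using k N T unfolding l_def by (simp add: field_simps)
    ultimately show ?thesis by simp
  qed
  also have "sqrt (real N) / sqrt T = sqrt (sqrt (real N / M))"
  proof -
    have "real N / T = sqrt (real N / M)"
      unfolding T_def using N M by (simp add: real_sqrt_mult real_sqrt_divide real_div_sqrt field_simps)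
    then show ?thesis by (simp add: real_sqrt_divide[symmetric])
  qed
  finally show ?thesis by (simp add: K_def)
qed

text \<open>The coefficients are at most twice those of a Fejer kernel centred at $N$, and the
corresponding two-sided sum \<open>G\<close> is bounded pointwise by the spacing of the Farey fractions.\<close>

lemma integral_norm_edge_le:
  fixes \<kappa> t :: "nat \<Rightarrow> real"
  assumes B: "B \<subseteq> {1..R}" and R: "1 \<le> R" "R\<^sup>2 \<le> H" and k: "k > 0" "\<And>q. q \<in> B \<Longrightarrow> \<bar>\<kappa> q\<bar> \<le> k"
    and t: "\<And>n. n \<le> N \<Longrightarrow> \<bar>t n\<bar> \<le> 1" "\<And>n. n + M \<le> N \<Longrightarrow> t n = 0" and M: "2 * M \<le> H"
  shows "integral {0..1} (\<lambda>\<alpha>. norm (\<Sum>n\<in>{1..N}. of_real (t n) *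
      (\<Sum>(q, a)\<in>(SIGMA q:B. reduced_residues q). of_real (\<kappa> q) * expo (real n * (real a / real q))) *
      expo (real n * \<alpha>))) \<le> 6 * k * real H"
proof -
  let ?F = "SIGMA q:B. reduced_residues q"
  define A :: "int \<Rightarrow> complex" where
    "A = (\<lambda>z. \<Sum>(q, a)\<in>?F. of_real (\<kappa> q) * expo (of_int z * (real a / real q)))"
  \<comment> \<open>Fejer coefficients recentred at \<open>N\<close>. The window continues beyond
    \<open>N\<close>, since a one-sided cut would bring the jump back; it may also reach below 0, so
    \<open>A\<close> is defined on the integers.\<close>
  define c where "c = (\<lambda>z::int. of_real (1 - \<bar>of_int (z - int N)\<bar> / real H) * A z)"
  define I where "I = {int N - int H<..<int N + int H}"
  define G where "G = (\<lambda>\<alpha>. \<Sum>z\<in>I. c z * expo (of_int z * \<alpha>))"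
  have H: "H > 0" using R by (cases H) auto
  have finB: "finite B" using B finite_subset by blast
  then have finF: "finite ?F" by auto
  have Geq: "G \<alpha> = (\<Sum>(q, a)\<in>?F. of_real (\<kappa> q / real H) * expo (real N * (\<alpha> + real a / real q)) *
      of_real (fejer H (\<alpha> + real a / real q)))" for \<alpha>
  proof -
    have "G \<alpha> = (\<Sum>h\<in>{- int H<..<int H}. c (int N + h) * expo (of_int (int N + h) * \<alpha>))"
      unfolding G_def I_def
      by (rule sum.reindex_bij_witness[of _ "\<lambda>h. int N + h" "\<lambda>z. z - int N"]) auto
    also have "\<dots> = (\<Sum>h\<in>{- int H<..<int H}. \<Sum>(q, a)\<in>?F. of_real (\<kappa> q / real H) * expo (real N * (\<alpha> + real a / real q)) *
      (of_int (int H - \<bar>h\<bar>) * expo (of_int h * (\<alpha> + real a / real q))))"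
    proof (intro sum.cong refl)
      fix h
      have *: "expo (real N * (\<alpha> + y)) * expo (of_int h * (\<alpha> + y)) =
          expo (of_int (int N + h) * y) * expo (of_int (int N + h) * \<alpha>)" for y
        by (simp add: expo_add[symmetric] algebra_simps)
      have **: "of_real (1 - \<bar>of_int (int N + h - int N)\<bar> / real H) = (of_int (int H - \<bar>h\<bar>) / of_real (real H) :: complex)"
      proof -
        have "real_of_int (int H - \<bar>h\<bar>) = real H - \<bar>of_int h\<bar>" by simp
        then have "(of_int (int H - \<bar>h\<bar>) :: complex) = of_real (real H - \<bar>of_int h\<bar>)"
          by (metis of_real_of_int_eq)
        then show ?thesis
          unfolding of_real_divide[symmetric] using H by (simp add: field_simps del: of_int_diff of_int_abs)
      qed
      show "c (int N + h) * expo (of_int (int N + h) * \<alpha>) = (\<Sum>(q, a)\<in>?F. of_real (\<kappa> q / real H) * expo (real N * (\<alpha> + real a / real q)) *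
      (of_int (int H - \<bar>h\<bar>) * expo (of_int h * (\<alpha> + real a / real q))))"
        unfolding c_def A_def sum_distrib_left sum_distrib_right **
      proof (intro sum.cong refl, clarify)
        fix q a
        show "of_int (int H - \<bar>h\<bar>) / of_real (real H) * (of_real (\<kappa> q) * expo (of_int (int N + h) * (real a / real q))) *
          expo (of_int (int N + h) * \<alpha>) = of_real (\<kappa> q / real H) * expo (real N * (\<alpha> + real a / real q)) *
          (of_int (int H - \<bar>h\<bar>) * expo (of_int h * (\<alpha> + real a / real q)))"
          using *[of "real a / real q"] by (simp add: mult_ac)
      qed
    qed
    also have "\<dots> = (\<Sum>(q, a)\<in>?F. of_real (\<kappa> q / real H) * expo (real N * (\<alpha> + real a / real q)) *
      of_real (fejer H (\<alpha> + real a / real q)))"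
      by (subst sum.swap) (simp add: fejer_expand sum_distrib_left case_prod_unfold)
    finally show ?thesis .
  qed
  have Gle: "norm (G \<alpha>) \<le> 3 * k * real H" for \<alpha>
  proof -
    have "norm (G \<alpha>) \<le> (\<Sum>(q, a)\<in>?F. k / real H * fejer H (\<alpha> + real a / real q))"
      unfolding Geq
    proof (rule order_trans[OF norm_sum], rule sum_mono, clarify)
      fix q a assume "q \<in> B" "a \<in> reduced_residues q"
      then show "norm (of_real (\<kappa> q / real H) * expo (real N * (\<alpha> + real a / real q)) *
          complex_of_real (fejer H (\<alpha> + real a / real q))) \<le> k / real H * fejer H (\<alpha> + real a / real q)"
        using k(2)[of q] fejer_nonneg[of H "\<alpha> + real a / real q"]
        by (simp add: norm_mult norm_divide mult_right_mono divide_right_mono)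
    qed
    also have "\<dots> = k / real H * (\<Sum>(q, a)\<in>?F. fejer H (\<alpha> + real a / real q))"
      by (simp add: sum_distrib_left case_prod_unfold)
    also have "(\<Sum>(q, a)\<in>?F. fejer H (\<alpha> + real a / real q)) \<le>
        (\<Sum>(q, a)\<in>(SIGMA q:{1..R}. reduced_residues q). fejer H (\<alpha> + real a / real q))"
      using B by (intro sum_mono2) (auto simp: fejer_nonneg)
    also have "\<dots> \<le> 3 * (real H)\<^sup>2" by (rule sum_fejer_farey_le[OF R])
    finally show ?thesis using k H by (simp add: power2_eq_square field_simps)
  qed
  \<comment> \<open>Parseval read backwards: the pointwise bound for \<open>G\<close> bounds the
    square sum of all its coefficients, and the one-sided ramp only needs those with index near N
    from below.\<close>
  have "(\<Sum>z\<in>I. (norm (c z))\<^sup>2) \<le> (3 * k * real H)\<^sup>2"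
  proof -
    have 1: "((\<lambda>\<alpha>. (norm (G \<alpha>))\<^sup>2) has_integral (\<Sum>z\<in>I. (norm (c z))\<^sup>2)) {0..1}"
      unfolding G_def by (rule parseval_int) (simp add: I_def)
    have 2: "((\<lambda>\<alpha>::real. (3 * k * real H)\<^sup>2) has_integral (3 * k * real H)\<^sup>2) {0..1}"
      using has_integral_const_real[of "(3 * k * real H)\<^sup>2" 0 1] by simp
    show ?thesis
      by (rule has_integral_le[OF 1 2]) (intro power_mono Gle, simp)
  qed
  moreover have "(\<Sum>n\<in>{1..N}. (norm (of_real (t n) * A (int n)))\<^sup>2) \<le> 4 * (\<Sum>z\<in>I. (norm (c z))\<^sup>2)"
  proof -
    have "(\<Sum>n\<in>{1..N}. (norm (of_real (t n) * A (int n)))\<^sup>2) = 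
       (\<Sum>n\<in>{n. n \<in> {1..N} \<and> N < n + M}. (norm (of_real (t n) * A (int n)))\<^sup>2)"
      using t(2) by (intro sum.mono_neutral_right) (auto simp: not_less)
    also have "\<dots> \<le> (\<Sum>n\<in>{n. n \<in> {1..N} \<and> N < n + M}. 4 * (norm (c (int n)))\<^sup>2)"
    proof (rule sum_mono)
      fix n assume n: "n \<in> {n. n \<in> {1..N} \<and> N < n + M}"
      have "real N - real n \<le> real M" "real n \<le> real N" "2 * real M \<le> real H"
        using n M by auto
      then have "1 / 2 \<le> 1 - \<bar>of_int (int n - int N)\<bar> / real H"
        using H by (simp add: field_simps)
      then have "1 / 2 \<le> \<bar>1 - \<bar>of_int (int n - int N)\<bar> / real H\<bar>"
        by (rule order_trans[OF _ abs_ge_self])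
      then have "1 \<le> 2 * \<bar>1 - \<bar>of_int (int n - int N)\<bar> / real H\<bar>"
        by simp
      moreover have "\<bar>t n\<bar> \<le> 1" using t(1) n by auto
      ultimately have "\<bar>t n\<bar> \<le> 2 * \<bar>1 - \<bar>of_int (int n - int N)\<bar> / real H\<bar>"
        by (rule order_trans[rotated])
      then have "norm (of_real (t n) * A (int n)) \<le> 2 * norm (c (int n))"
        unfolding c_def norm_mult norm_of_real mult.assoc[symmetric] by (intro mult_right_mono) auto
      then have "(norm (of_real (t n) * A (int n)))\<^sup>2 \<le> (2 * norm (c (int n)))\<^sup>2"
        by (intro power_mono) auto
      then show "(norm (of_real (t n) * A (int n)))\<^sup>2 \<le> 4 * (norm (c (int n)))\<^sup>2"
        by (simp add: power_mult_distrib)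
    qed
    also have "\<dots> = 4 * (\<Sum>z\<in>int ` {n. n \<in> {1..N} \<and> N < n + M}. (norm (c z))\<^sup>2)"
      by (simp add: sum_distrib_left sum.reindex)
    also have "\<dots> \<le> 4 * (\<Sum>z\<in>I. (norm (c z))\<^sup>2)"
      using M H by (intro mult_left_mono sum_mono2) (auto simp: I_def)
    finally show ?thesis .
  qed
  ultimately have le: "(\<Sum>n\<in>{1..N}. (norm (of_real (t n) * A (int n)))\<^sup>2) \<le> (6 * k * real H)\<^sup>2"
    by (simp add: power_mult_distrib)
  have "integral {0..1} (\<lambda>\<alpha>. norm (\<Sum>n\<in>{1..N}. (of_real (t n) * A (int n)) * expo (real n * \<alpha>))) \<le> 6 * k * real H"
    using k H by (intro integral_norm_le_of_L2[OF _ parseval_nat le] continuous_intros) auto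
  then show ?thesis by (simp add: A_def)
qed

section \<open>A smoothed Ramanujan expansion of the divisor function\<close>

lemma expo_eq_1_iff: "expo t = 1 \<longleftrightarrow> t \<in> \<int>"
  using norm_expo_diff[of t] sin_times_pi_eq_0[of t] by (auto simp: mult.commute)

lemma sum_expo_complete:
  assumes "m > 0"
  shows "(\<Sum>l<m. expo (real n * (real l / real m))) = (if m dvd n then of_nat m else 0)"
proof -
  let ?z = "expo (real n / real m)"
  have s: "(\<Sum>l<m. expo (real n * (real l / real m))) = (\<Sum>l<m. ?z ^ l)"
    by (simp add: expo_nat_mult[symmetric] mult_ac)
  have z1: "?z = 1 \<longleftrightarrow> m dvd n"
  proof
    assume "?z = 1"
    then obtain k where "real n / real m = of_int k"
      by (auto simp: expo_eq_1_iff elim: Ints_cases)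
    then have "real_of_int (int n) = real_of_int (k * int m)"
      using assms by (simp add: field_simps)
    then have "int n = k * int m" by (simp only: of_int_eq_iff)
    then have "int m dvd int n" by simp
    then show "m dvd n" by simp
  next
    assume "m dvd n"
    then show "?z = 1" using assms by (auto simp: expo_eq_1_iff)
  qed
  have "?z ^ m = 1"
    using assms expo_of_int[of "int n"] by (simp add: expo_nat_mult[symmetric])
  then show ?thesis unfolding s using z1 by (auto simp: geometric_sum)
qed

text \<open>The involution $m \<mapsto> n/m$ turns the weight $w$ into $1 - w$.\<close>

lemma divisor_count_hyperbola:
  assumes n: "1 \<le> n" "n \<le> N"
  shows "real (divisor_count n) = 2 * (\<Sum>m | m \<in> {1..N} \<and> m dvd n. real n / ((real m)\<^sup>2 + real n))"
proof -
  let ?D = "{m. m dvd n}" and ?f = "\<lambda>m. real n / ((real m)\<^sup>2 + real n)"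
  have D: "{m \<in> {1..N}. m dvd n} = ?D"
    using n by (auto dest: dvd_imp_le intro: Suc_leI dvd_pos_nat)
  have fin: "finite ?D" using n by simp
  have "sum ?f ?D = (\<Sum>m\<in>?D. ?f (n div m))"
    by (rule sum.reindex_bij_witness[of _ "\<lambda>m. n div m" "\<lambda>m. n div m"]) (use n in \<open>auto simp: div_dvd_iff_mult dvd_div_eq_mult\<close>)
  also have "\<dots> = (\<Sum>m\<in>?D. 1 - ?f m)"
  proof (intro sum.cong refl)
    fix m assume "m \<in> ?D"
    then obtain d where d: "n = m * d" by auto
    with n have pos: "m > 0" "d > 0" by auto
    have nz: "real d ^ 2 + real m * real d \<noteq> 0" "real m ^ 2 + real m * real d \<noteq> 0"
      using pos by (auto simp: add_nonneg_eq_0_iff)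
    have "n div m = d" using d pos by simp
    then show "?f (n div m) = 1 - ?f m"
      using d nz pos by (simp add: divide_simps) (simp add: power2_eq_square algebra_simps)
  qed
  also have "\<dots> = real (card ?D) - sum ?f ?D" by (simp add: sum_subtractf)
  finally show ?thesis unfolding D divisor_count_def by simp
qed

text \<open>The coefficient of the Ramanujan sum c_q(n) in d(n)/2: the factor 1/m comes from
  detecting m | n by the m characters modulo m, the condition q | m from reducing l/m. The cutoff N
  loses no divisor of n when n <= N, and being independent of n it keeps \<open>kap N q\<close>
  monotone.\<close>

definition kap :: "nat \<Rightarrow> nat \<Rightarrow> nat \<Rightarrow> real" where
  "kap N q n = (\<Sum>m | m \<in> {1..N} \<and> q dvd m. 1 / real m * (real n / ((real m)\<^sup>2 + real n)))"

lemma divisor_count_ramanujan: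
  assumes n: "1 \<le> n" "n \<le> N"
  shows "of_nat (divisor_count n) =
    2 * (\<Sum>q\<in>{1..N}. of_real (kap N q n) * (\<Sum>a\<in>reduced_residues q. expo (real n * (real a / real q))))"
proof -
  let ?w = "\<lambda>m. complex_of_real (1 / real m * (real n / ((real m)\<^sup>2 + real n)))"
  let ?r = "\<lambda>q. \<Sum>a\<in>reduced_residues q. expo (real n * (real a / real q))"
  have "of_nat (divisor_count n) = complex_of_real (real (divisor_count n))" by simp
  also have "\<dots> = 2 * (\<Sum>m | m \<in> {1..N} \<and> m dvd n. ?w m * of_nat m)"
  proof -
    have "real n / ((real m)\<^sup>2 + real n) = 1 / real m * (real n / ((real m)\<^sup>2 + real n)) * real m"
      if "m \<in> {1..N}" for m
      using that by simp
    then have "real (divisor_count n) = 2 * (\<Sum>m | m \<in> {1..N} \<and> m dvd n.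
        1 / real m * (real n / ((real m)\<^sup>2 + real n)) * real m)"
      unfolding divisor_count_hyperbola[OF n] by (intro arg_cong[where f = "\<lambda>x. 2 * x"] sum.cong refl) blast
    then show ?thesis by (simp only: of_real_mult of_real_sum of_real_numeral of_real_of_nat_eq)
  qed
  also have "(\<Sum>m | m \<in> {1..N} \<and> m dvd n. ?w m * of_nat m) =
      (\<Sum>m\<in>{1..N}. ?w m * (\<Sum>l<m. expo (real n * (real l / real m))))"
  proof -
    have "(\<Sum>m | m \<in> {1..N} \<and> m dvd n. ?w m * of_nat m) =
        (\<Sum>m\<in>{1..N}. if m dvd n then ?w m * of_nat m else 0)"
      by (rule sum.inter_filter) simp
    also have "\<dots> = (\<Sum>m\<in>{1..N}. ?w m * (\<Sum>l<m. expo (real n * (real l / real m))))"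
    proof (intro sum.cong refl)
      fix m assume "m \<in> {1..N}"
      then have "m > 0" by simp
      from sum_expo_complete[OF this, of n]
      show "(if m dvd n then ?w m * of_nat m else 0) = ?w m * (\<Sum>l<m. expo (real n * (real l / real m)))"
        by (simp only: mult_zero_right split: if_split) blast
    qed
    finally show ?thesis .
  qed
  also have "\<dots> = (\<Sum>m\<in>{1..N}. \<Sum>q | q \<in> {1..N} \<and> q dvd m. ?w m * ?r q)"
  proof (intro sum.cong refl)
    fix m assume m: "m \<in> {1..N}"
    have "{q. q dvd m} = {q. q \<in> {1..N} \<and> q dvd m}"
      using m by (auto dest: dvd_imp_le intro: Suc_leI dvd_pos_nat)
    then show "?w m * (\<Sum>l<m. expo (real n * (real l / real m))) =
        (\<Sum>q | q \<in> {1..N} \<and> q dvd m. ?w m * ?r q)"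
      using m sum_fractions[of m "\<lambda>x. expo (real n * x)"] by (simp add: sum_distrib_left)
  qed
  also have "\<dots> = (\<Sum>q\<in>{1..N}. \<Sum>m | m \<in> {1..N} \<and> q dvd m. ?w m * ?r q)"
    by (rule sum.swap_restrict) auto
  finally show ?thesis by (simp add: kap_def sum_distrib_right)
qed

section \<open>Size and growth of the Ramanujan coefficients\<close>

lemma sum_multiples_le:
  fixes q :: nat
  assumes "q > 0" "\<And>m. f m \<ge> (0::real)"
  shows "(\<Sum>m | m \<in> {1..N} \<and> q dvd m. f m) \<le> (\<Sum>g\<in>{1..N}. f (g * q))"
proof -
  have "(\<Sum>m | m \<in> {1..N} \<and> q dvd m. f m) = sum f ((\<lambda>g. g * q) ` {g. g \<in> {1..N} \<and> g * q \<le> N})"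
  proof (rule arg_cong[where f = "sum f"], intro equalityI subsetI)
    fix m assume m: "m \<in> {m. m \<in> {1..N} \<and> q dvd m}"
    then have "m = (m div q) * q" by simp
    then obtain g where g: "m = g * q" by blast
    have "g \<le> g * q" using assms by simp
    also have "\<dots> \<le> N" using m g by auto
    finally have "g \<le> N" .
    moreover have "g \<ge> 1" using m g by (cases g) auto
    ultimately show "m \<in> (\<lambda>g. g * q) ` {g. g \<in> {1..N} \<and> g * q \<le> N}"
      using m g by (intro image_eqI[of _ _ g]) auto
  qed (use assms in auto)
  also have "\<dots> = (\<Sum>g | g \<in> {1..N} \<and> g * q \<le> N. f (g * q))"
    using assms by (subst sum.reindex) (auto simp: inj_on_def)
  also have "\<dots> \<le> (\<Sum>g\<in>{1..N}. f (g * q))"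
    using assms by (intro sum_mono2) auto
  finally show ?thesis .
qed

lemma sum_multiples_inverse_cubes_le:
  assumes "q > 0"
  shows "(\<Sum>m | m \<in> {1..N} \<and> q dvd m. 1 / (real m)^3) \<le> 2 / (real q)^3"
proof -
  have "(\<Sum>m | m \<in> {1..N} \<and> q dvd m. 1 / (real m)^3) \<le> (\<Sum>g\<in>{1..N}. 1 / (real (g * q))^3)"
    using assms by (intro sum_multiples_le) auto
  \<comment> \<open>A factor g is given away, g^3 >= g^2, so that the bound 2 for inverse squares
    applies.\<close>
  also have "\<dots> \<le> (\<Sum>g\<in>{1..N}. 1 / (real q)^3 * (1 / (real g)\<^sup>2))"
    using assms by (intro sum_mono) (auto simp: field_simps power_mult_distrib intro!: power_increasing)
  also have "\<dots> = 1 / (real q)^3 * (\<Sum>g\<in>{1..N}. 1 / (real g)\<^sup>2)"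
    by (simp only: sum_distrib_left)
  also have "(\<Sum>g\<in>{1..N}. 1 / (real g)\<^sup>2) \<le> (\<Sum>g<Suc N. 1 / (real g)\<^sup>2)"
    by (intro sum_mono2) auto
  also have "\<dots> \<le> 2" by (rule sum_inverse_squares_le)
  finally show ?thesis by (simp add: divide_right_mono)
qed

lemma kap_0 [simp]: "kap N q 0 = 0"
  by (simp add: kap_def)

text \<open>The ratio n / (m^2 + n) grows by m^2 / ((m^2 + n + 1)(m^2 + n)) <= 1/m^2 in one step,
  and the outer 1/m makes this 1/m^3. The sign yields a telescoping total variation, the size a
  bound for the largest step; together they control the sum of squared differences.\<close>

lemma kap_increment:
  assumes "q > 0"
  shows "0 \<le> kap N q (Suc n) - kap N q n" "kap N q (Suc n) - kap N q n \<le> 2 / (real q)^3"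
proof -
  have eq: "kap N q (Suc n) - kap N q n = (\<Sum>m | m \<in> {1..N} \<and> q dvd m.
      1 / real m * (real (Suc n) / ((real m)\<^sup>2 + real (Suc n)) - real n / ((real m)\<^sup>2 + real n)))"
    by (simp add: kap_def sum_subtractf[symmetric] right_diff_distrib)
  have d: "real (Suc n) / (x + real (Suc n)) - real n / (x + real n) = x / ((x + real (Suc n)) * (x + real n))"
    if "x > 0" for x :: real
    using that by (simp add: divide_simps add_pos_nonneg) (simp add: algebra_simps)
  have *: "0 \<le> real (Suc n) / ((real m)\<^sup>2 + real (Suc n)) - real n / ((real m)\<^sup>2 + real n)"
     "real (Suc n) / ((real m)\<^sup>2 + real (Suc n)) - real n / ((real m)\<^sup>2 + real n) \<le> 1 / (real m)\<^sup>2" if "m > 0" for m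
  proof -
    have x: "(real m)\<^sup>2 > 0" using that by simp
    have "x / ((x + real (Suc n)) * (x + real n)) \<le> x / (x * x)" if "x > 0" for x :: real
      using that by (intro divide_left_mono mult_mono mult_pos_pos) auto
    from this[OF x] show "real (Suc n) / ((real m)\<^sup>2 + real (Suc n)) - real n / ((real m)\<^sup>2 + real n) \<le> 1 / (real m)\<^sup>2"
      unfolding d[OF x] using x by (simp only: nonzero_divide_mult_cancel_left)
    show "0 \<le> real (Suc n) / ((real m)\<^sup>2 + real (Suc n)) - real n / ((real m)\<^sup>2 + real n)"
      unfolding d[OF x] by simp
  qed
  show "0 \<le> kap N q (Suc n) - kap N q n"
    unfolding eq using * by (intro sum_nonneg mult_nonneg_nonneg) auto
  have "kap N q (Suc n) - kap N q n \<le> (\<Sum>m | m \<in> {1..N} \<and> q dvd m. 1 / real m * (1 / (real m)\<^sup>2))"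
    unfolding eq using * by (intro sum_mono mult_left_mono) auto
  also have "\<dots> = (\<Sum>m | m \<in> {1..N} \<and> q dvd m. 1 / (real m)^3)"
    by (simp add: power2_eq_square power3_eq_cube mult.assoc)
  also have "\<dots> \<le> 2 / (real q)^3" by (rule sum_multiples_inverse_cubes_le[OF assms])
  finally show "kap N q (Suc n) - kap N q n \<le> 2 / (real q)^3" .
qed

lemma kap_mono:
  assumes "q > 0" "n \<le> n'"
  shows "kap N q n \<le> kap N q n'"
proof (rule lift_Suc_mono_le[OF _ assms(2)])
  show "kap N q i \<le> kap N q (Suc i)" for i
    using kap_increment(1)[OF assms(1), of N i] by simp
qed

lemma kap_nonneg: "0 \<le> kap N q n"
  unfolding kap_def by (intro sum_nonneg) auto

text \<open>Dropping N from the denominator m^2 + N is cheap once q exceeds sqrt N, so this is the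
  bound for large denominators; well below sqrt N, \<open>kap_le_powr\<close> is stronger.\<close>

lemma kap_le_cube:
  assumes "q > 0"
  shows "kap N q N \<le> 2 * real N / (real q)^3"
proof -
  have "kap N q N \<le> (\<Sum>m | m \<in> {1..N} \<and> q dvd m. real N * (1 / (real m)^3))"
    unfolding kap_def
  proof (rule sum_mono)
    fix m assume "m \<in> {m. m \<in> {1..N} \<and> q dvd m}"
    then have m: "m > 0" by auto
    then have "real N / ((real m)\<^sup>2 + real N) \<le> real N / (real m)\<^sup>2"
      by (intro divide_left_mono) (auto intro!: mult_pos_pos add_pos_nonneg)
    then have "1 / real m * (real N / ((real m)\<^sup>2 + real N)) \<le> 1 / real m * (real N / (real m)\<^sup>2)"
      by (intro mult_left_mono) auto
    then show "1 / real m * (real N / ((real m)\<^sup>2 + real N)) \<le> real N * (1 / (real m)^3)"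
      by (simp add: power2_eq_square power3_eq_cube mult.assoc)
  qed
  also have "\<dots> = real N * (\<Sum>m | m \<in> {1..N} \<and> q dvd m. 1 / (real m)^3)"
    by (simp add: sum_distrib_left)
  also have "\<dots> \<le> real N * (2 / (real q)^3)"
    by (intro mult_left_mono sum_multiples_inverse_cubes_le assms) auto
  finally show ?thesis by (simp add: mult.commute)
qed

text \<open>The Riemann zeta value at 5/4; the term g = 0 is 0 by the convention for
  \<open>powr\<close>. The exponent is 1 + 2/8, where 1/8 is the power of N allowed in
  \<open>kap_le_powr\<close>.\<close>

definition zeta54 :: real where
  "zeta54 = (\<Sum>g. real g powr (- (5/4)))"

lemma sum_powr_le_zeta54: "finite A \<Longrightarrow> (\<Sum>g\<in>A. real g powr (- (5/4))) \<le> zeta54"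
  unfolding zeta54_def by (intro sum_le_suminf) (auto simp: summable_real_powr_iff)

lemma zeta54_ge_1: "1 \<le> zeta54"
  using sum_powr_le_zeta54[of "{1}"] by simp

text \<open>Any exponent in $(0, 1/4)$ instead of $1/8$ would make the dyadic sum over
$q \<le> \<surd>N$ converge geometrically.\<close>

lemma kap_le_powr:
  assumes "q > 0"
  shows "kap N q N \<le> zeta54 * real N powr (1/8) * real q powr (- (5/4))"
proof -
  have "kap N q N \<le> (\<Sum>m | m \<in> {1..N} \<and> q dvd m. real N powr (1/8) * real m powr (- (5/4)))"
    unfolding kap_def
  proof (rule sum_mono)
    fix m assume "m \<in> {m. m \<in> {1..N} \<and> q dvd m}"
    then have m: "m > 0" "N > 0" by auto
    define x where "x = real N / (real m)\<^sup>2"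
    have x: "x > 0" using m by (simp add: x_def)
    \<comment> \<open>The ratio is at most min(1, x), and min(1, x) <= x^c for every c in
      [0, 1].\<close>
    have "real N / ((real m)\<^sup>2 + real N) \<le> x powr (1/8)"
    proof (cases "x \<le> 1")
      case True
      have "real N / ((real m)\<^sup>2 + real N) \<le> x"
        unfolding x_def using m by (intro divide_left_mono) (auto intro!: mult_pos_pos add_pos_nonneg)
      also have "x = x powr 1" using x by simp
      also have "\<dots> \<le> x powr (1/8)" using x True by (intro powr_mono') auto
      finally show ?thesis .
    next
      case False
      have "real N / ((real m)\<^sup>2 + real N) \<le> 1" using m by (simp add: divide_le_eq_1 add_pos_pos)
      also have "1 = 1 powr (1/8 :: real)" by simp
      also have "\<dots> \<le> x powr (1/8)" using False by (intro powr_mono2) auto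
      finally show ?thesis .
    qed
    also have "x powr (1/8) = real N powr (1/8) * real m powr (- (1/4))"
    proof -
      have "(real m)\<^sup>2 = real m powr 2" using m by simp
      then have "(real m)\<^sup>2 powr (1/8) = real m powr (1/4)" by (simp only: powr_powr) simp
      moreover have "x powr (1/8) = real N powr (1/8) / (real m)\<^sup>2 powr (1/8)"
        unfolding x_def by (rule powr_divide)
      ultimately show ?thesis by (simp only: powr_minus_divide times_divide_eq_right mult_1_right)
    qed
    finally have "1 / real m * (real N / ((real m)\<^sup>2 + real N)) \<le> 1 / real m * (real N powr (1/8) * real m powr (- (1/4)))"
      by (intro mult_left_mono) auto
    also have "\<dots> = real N powr (1/8) * (real m powr (-1) * real m powr (- (1/4)))"
    proof -
      have "1 / real m = real m powr (-1)" using m by (simp add: powr_minus_divide)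
      then show ?thesis by (simp only: mult.left_commute)
    qed
    also have "\<dots> = real N powr (1/8) * real m powr (- (5/4))"
      by (simp only: powr_add[symmetric]) simp
    finally show "1 / real m * (real N / ((real m)\<^sup>2 + real N)) \<le> real N powr (1/8) * real m powr (- (5/4))" .
  qed
  also have "\<dots> \<le> (\<Sum>g\<in>{1..N}. real N powr (1/8) * real (g * q) powr (- (5/4)))"
    using assms by (intro sum_multiples_le) auto
  also have "\<dots> = real N powr (1/8) * real q powr (- (5/4)) * (\<Sum>g\<in>{1..N}. real g powr (- (5/4)))"
    by (simp add: powr_mult sum_distrib_left mult_ac)
  also have "\<dots> \<le> real N powr (1/8) * real q powr (- (5/4)) * zeta54"
    by (intro mult_left_mono sum_powr_le_zeta54) auto
  finally show ?thesis by (simp add: mult_ac)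
qed

section \<open>The upper bound\<close>

lemma sum_diff_telescope: "(\<Sum>n\<in>{1..N}. f n - f (n - 1)) = f N - f 0" for f :: "nat \<Rightarrow> real"
  by (induction N) auto

lemma continuous_on_trig_sum [continuous_intros]:
  "continuous_on A (\<lambda>\<alpha>. \<Sum>n\<in>I. c n * expo (real n * (\<alpha> + x)))"
  by (intro continuous_intros)

text \<open>\<open>M\<close> is the ramp length; it will be Q^2 or N, whichever is smaller. The
  hypothesis on 1/Q^3 keeps the steps of \<open>kap\<close> at most 2k/M, comparable with those of
  the ramp. With s the fourth root of N/M, at most 2 Q^2 fractions cost 3 k s each and the joint
  ramp costs 24 k Q^2; as s >= 1, these add up to 30 k Q^2 s.\<close>

lemma integral_norm_block_le:
  assumes B: "B \<subseteq> {Q..<2 * Q}" and Q: "1 \<le> Q" and M: "1 \<le> M" "M \<le> N" "M \<le> Q\<^sup>2"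
    and k: "k > 0" "\<And>q. q \<in> B \<Longrightarrow> kap N q N \<le> k" and slope: "1 / (real Q)^3 \<le> k / real M"
  shows "integral {0..1} (\<lambda>\<alpha>. norm (\<Sum>n\<in>{1..N}. (\<Sum>q\<in>B. of_real (kap N q n) *
      (\<Sum>a\<in>reduced_residues q. expo (real n * (real a / real q)))) * expo (real n * \<alpha>)))
    \<le> 30 * k * (real Q)\<^sup>2 * sqrt (sqrt (real N / real M))"
proof -
  \<comment> \<open>The ramp vanishes up to N - M and rises linearly to 1 at N. It does not depend
    on q, so the end corrections \<open>kap N q N * t n\<close> share one profile and can be added
    before any norm is taken.\<close>
  define t where "t = (\<lambda>n. max 0 (1 - (real N - real n) / real M))"
  define v where "v = (\<lambda>q n. kap N q n - kap N q N * t n)"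
  define s where "s = sqrt (sqrt (real N / real M))"
  let ?F = "SIGMA q:B. reduced_residues q"
  let ?c = "\<lambda>n q a. expo (real n * (real a / real q))"
  have pos: "real M > 0" "real N > 0" using M by auto
  have s1: "s \<ge> 1" unfolding s_def using M by simp
  have finB: "finite B" using B finite_subset by blast
  have qB: "Q \<le> q" "q < 2 * Q" "q > 0" if "q \<in> B" for q using B Q that by force+
  have t01: "0 \<le> t n" "t n \<le> 1" if "n \<le> N" for n
    using that pos by (auto simp: t_def)
  have t_inc: "0 \<le> t n - t (n - 1)" "t n - t (n - 1) \<le> 1 / real M" if "n \<ge> 1" for n
  proof -
    have "real (n - 1) = real n - 1" using that by simp
    then have "(real N - real (n - 1)) / real M = (real N - real n) / real M + 1 / real M"
      by (simp add: diff_divide_distrib)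
    moreover have "1 / real M > 0" using pos by simp
    ultimately show "0 \<le> t n - t (n - 1)" "t n - t (n - 1) \<le> 1 / real M"
      unfolding t_def by linarith+
  qed
  have t0: "t n = 0" if "n + M \<le> N" for n
  proof -
    have "real n + real M \<le> real N" using that by (simp flip: of_nat_add)
    then show ?thesis unfolding t_def using pos by (simp add: field_simps)
  qed
  have tN: "t N = 1" by (simp add: t_def)
  have smooth: "integral {0..1} (\<lambda>\<alpha>. norm (\<Sum>n\<in>{1..N}. of_real (v q n) * expo (real n * (\<alpha> + x)))) \<le> 3 * k * s"
    if q: "q \<in> B" for q x
    unfolding s_def
  proof (rule integral_norm_smooth_le)
    note q0 = qB(3)[OF q]
    note kN = k(2)[OF q]
    have kk: "0 \<le> kap N q N" by (rule kap_nonneg)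
    show "v q 0 = 0" using t0[of 0] M by (simp add: v_def)
    show "v q N = 0" by (simp add: v_def tN)
    show "\<bar>v q n\<bar> \<le> k" if "n \<le> N" for n
    proof -
      have "kap N q N * t n \<le> kap N q N * 1" "0 \<le> kap N q N * t n"
        using t01[OF that] kk by (auto intro: mult_left_mono simp del: mult_1_right)
      moreover have "0 \<le> kap N q n" "kap N q n \<le> kap N q N"
        using kap_nonneg kap_mono[OF q0 that] by auto
      ultimately show ?thesis unfolding v_def using kN by linarith
    qed
    define dk where "dk = (\<lambda>n. kap N q n - kap N q (n - 1))"
    define dt where "dt = (\<lambda>n. kap N q N * t n - kap N q N * t (n - 1))"
    have dv: "v q n - v q (n - 1) = dk n - dt n" for n
      by (simp add: v_def dk_def dt_def)
    have dk: "0 \<le> dk n" "dk n \<le> 2 * k / real M" if "n \<in> {1..N}" for n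
    proof -
      have *: "0 \<le> dk n" "dk n \<le> 2 / (real q)^3"
        using kap_increment[OF q0, of N "n - 1"] that by (auto simp: dk_def)
      then show "0 \<le> dk n" by simp
      have "(real Q)^3 \<le> (real q)^3" using qB[OF q] by (intro power_mono) auto
      then have "2 / (real q)^3 \<le> 2 * (1 / (real Q)^3)"
        using Q by (simp add: divide_left_mono)
      then show "dk n \<le> 2 * k / real M" using * slope by simp
    qed
    have dt: "0 \<le> dt n" "dt n \<le> k / real M" if "n \<in> {1..N}" for n
    proof -
      have n: "n \<ge> 1" using that by simp
      have "dt n = kap N q N * (t n - t (n - 1))" by (simp add: dt_def right_diff_distrib)
      moreover have "kap N q N * (t n - t (n - 1)) \<le> k * (1 / real M)"
        using t_inc[OF n] kN kk k by (intro mult_mono) auto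
      ultimately show "0 \<le> dt n" "dt n \<le> k / real M"
        using t_inc(1)[OF n] kk by auto
    qed
    \<comment> \<open>A sum of squares is at most the largest step times the total variation. The
      steps are at most 2k/M; the increments of \<open>kap\<close> and of the ramp are nonnegative
      and each telescope to \<open>kap N q N\<close>, which is at most k.\<close>
    have "(\<Sum>n\<in>{1..N}. (v q n - v q (n - 1))\<^sup>2) \<le> (\<Sum>n\<in>{1..N}. 2 * k / real M * (dk n + dt n))"
    proof (rule sum_mono)
      fix n assume n: "n \<in> {1..N}"
      have kM: "k / real M > 0" using k pos by simp
      have "\<bar>dk n - dt n\<bar> \<le> 2 * k / real M" "\<bar>dk n - dt n\<bar> \<le> dk n + dt n"
        using dk[OF n] dt[OF n] kM by (auto simp: abs_le_iff)
      then have "\<bar>dk n - dt n\<bar> * \<bar>dk n - dt n\<bar> \<le> 2 * k / real M * (dk n + dt n)"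
        using kM by (intro mult_mono) auto
      then show "(v q n - v q (n - 1))\<^sup>2 \<le> 2 * k / real M * (dk n + dt n)"
        unfolding dv power2_eq_square by simp
    qed
    also have "\<dots> = 2 * k / real M * ((\<Sum>n\<in>{1..N}. dk n) + (\<Sum>n\<in>{1..N}. dt n))"
      unfolding sum.distrib[symmetric] sum_distrib_left ..
    also have "(\<Sum>n\<in>{1..N}. dk n) = kap N q N"
      unfolding dk_def using sum_diff_telescope[of "kap N q" N] by simp
    also have "(\<Sum>n\<in>{1..N}. dt n) = kap N q N"
      unfolding dt_def using sum_diff_telescope[of "\<lambda>n. kap N q N * t n" N] t0[of 0] M tN by simp
    also have "2 * k / real M * (kap N q N + kap N q N) \<le> 2 * k / real M * (k + k)"
      using k pos kN by (intro mult_left_mono) auto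
    finally show "(\<Sum>n\<in>{1..N}. (v q n - v q (n - 1))\<^sup>2) \<le> 4 * k\<^sup>2 / real M"
      by (simp add: power2_eq_square)
  qed (use k M in auto)
  define E where "E = (\<lambda>\<alpha>. \<Sum>n\<in>{1..N}. of_real (t n) * (\<Sum>(q, a)\<in>?F. of_real (kap N q N) * ?c n q a) * expo (real n * \<alpha>))"
  define V where "V = (\<lambda>q a \<alpha>. \<Sum>n\<in>{1..N}. of_real (v q n) * expo (real n * (\<alpha> + real a / real q)))"
  have contE: "continuous_on A E" for A
    unfolding E_def by (intro continuous_intros)
  have contV: "continuous_on A (V q a)" for A q a
    unfolding V_def by (rule continuous_on_trig_sum)
  \<comment> \<open>Taken with R = 2Q and H = R^2, the shortest Fejer length that the spacing bound
    admits; 2M <= H then follows from M <= Q^2.\<close>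
  have edge: "integral {0..1} (\<lambda>\<alpha>. norm (E \<alpha>)) \<le> 6 * k * real ((2 * Q)\<^sup>2)"
    unfolding E_def
  proof (rule integral_norm_edge_le)
    show "B \<subseteq> {1..2 * Q}" using qB by force
    show "\<bar>kap N q N\<bar> \<le> k" if "q \<in> B" for q
      using k(2)[OF that] kap_nonneg[of N q N] by simp
    show "\<bar>t n\<bar> \<le> 1" if "n \<le> N" for n using t01[OF that] by simp
    show "2 * M \<le> (2 * Q)\<^sup>2" using M by (simp add: power_mult_distrib)
  qed (use Q k t0 in auto)
  have split: "(\<Sum>n\<in>{1..N}. (\<Sum>q\<in>B. of_real (kap N q n) * (\<Sum>a\<in>reduced_residues q. ?c n q a)) * expo (real n * \<alpha>))
      = (\<Sum>(q, a)\<in>?F. V q a \<alpha>) + E \<alpha>" for \<alpha>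
  proof -
    have "(\<Sum>q\<in>B. of_real (kap N q n) * (\<Sum>a\<in>reduced_residues q. ?c n q a)) * expo (real n * \<alpha>) =
       (\<Sum>(q, a)\<in>?F. of_real (v q n) * expo (real n * (\<alpha> + real a / real q))) +
       of_real (t n) * (\<Sum>(q, a)\<in>?F. of_real (kap N q N) * ?c n q a) * expo (real n * \<alpha>)" for n
    proof -
      have "(\<Sum>q\<in>B. of_real (kap N q n) * (\<Sum>a\<in>reduced_residues q. ?c n q a)) * expo (real n * \<alpha>) =
        (\<Sum>(q, a)\<in>?F. of_real (kap N q n) * ?c n q a) * expo (real n * \<alpha>)"
        using finB by (simp add: sum_distrib_left sum.Sigma)
      also have "\<dots> = (\<Sum>(q, a)\<in>?F. of_real (v q n) * expo (real n * (\<alpha> + real a / real q)) +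
          of_real (t n) * (of_real (kap N q N) * ?c n q a) * expo (real n * \<alpha>))"
        unfolding sum_distrib_right
        by (intro sum.cong refl) (auto simp: v_def distrib_left expo_add algebra_simps simp del: times_divide_eq_right)
      also have "\<dots> = (\<Sum>(q, a)\<in>?F. of_real (v q n) * expo (real n * (\<alpha> + real a / real q))) +
         of_real (t n) * (\<Sum>(q, a)\<in>?F. of_real (kap N q N) * ?c n q a) * expo (real n * \<alpha>)"
        by (simp only: sum.distrib sum_distrib_left sum_distrib_right case_prod_unfold)
      finally show ?thesis .
    qed
    then have "(\<Sum>n\<in>{1..N}. (\<Sum>q\<in>B. of_real (kap N q n) * (\<Sum>a\<in>reduced_residues q. ?c n q a)) * expo (real n * \<alpha>)) =
       (\<Sum>n\<in>{1..N}. \<Sum>(q, a)\<in>?F. of_real (v q n) * expo (real n * (\<alpha> + real a / real q))) + E \<alpha>"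
      by (simp only: sum.distrib E_def)
    also have "(\<Sum>n\<in>{1..N}. \<Sum>(q, a)\<in>?F. of_real (v q n) * expo (real n * (\<alpha> + real a / real q))) = (\<Sum>(q, a)\<in>?F. V q a \<alpha>)"
      unfolding V_def by (subst sum.swap) (simp only: case_prod_unfold)
    finally show ?thesis .
  qed
  have card: "real (card ?F) \<le> 2 * (real Q)\<^sup>2"
  proof -
    have "card ?F = (\<Sum>q\<in>B. card (reduced_residues q))" using finB by simp
    also have "\<dots> \<le> (\<Sum>q\<in>B. 2 * Q)"
      using qB card_reduced_le by (intro sum_mono) (meson le_trans less_imp_le)
    also have "\<dots> \<le> Q * (2 * Q)"
      using card_mono[OF _ B] by simp
    finally have "card ?F \<le> 2 * Q\<^sup>2" by (simp add: power2_eq_square)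
    then show ?thesis by (simp flip: of_nat_power of_nat_mult)
  qed
  have "integral {0..1} (\<lambda>\<alpha>. norm (\<Sum>n\<in>{1..N}. (\<Sum>q\<in>B. of_real (kap N q n) *
      (\<Sum>a\<in>reduced_residues q. ?c n q a)) * expo (real n * \<alpha>)))
    \<le> integral {0..1} (\<lambda>\<alpha>. (\<Sum>(q, a)\<in>?F. norm (V q a \<alpha>)) + norm (E \<alpha>))"
    unfolding split
  proof (intro integral_le integrable_continuous_real)
    show "continuous_on {0..1} (\<lambda>\<alpha>. norm ((\<Sum>(q, a)\<in>?F. V q a \<alpha>) + E \<alpha>))"
      unfolding case_prod_unfold by (intro continuous_intros contV contE)
    show "continuous_on {0..1} (\<lambda>\<alpha>. (\<Sum>(q, a)\<in>?F. norm (V q a \<alpha>)) + norm (E \<alpha>))"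
      unfolding case_prod_unfold by (intro continuous_intros contV contE)
    show "norm ((\<Sum>(q, a)\<in>?F. V q a \<alpha>) + E \<alpha>) \<le> (\<Sum>(q, a)\<in>?F. norm (V q a \<alpha>)) + norm (E \<alpha>)" for \<alpha>
      unfolding case_prod_unfold
      by (rule order_trans[OF norm_triangle_ineq add_right_mono[OF norm_sum]])
  qed
  also have "\<dots> = (\<Sum>(q, a)\<in>?F. integral {0..1} (\<lambda>\<alpha>. norm (V q a \<alpha>))) + integral {0..1} (\<lambda>\<alpha>. norm (E \<alpha>))"
    unfolding case_prod_unfold using finB
    by (subst integral_add) (auto intro!: integrable_continuous_real continuous_intros contV contE integral_sum)
  also have "\<dots> \<le> (\<Sum>(q, a)\<in>?F. 3 * k * s) + 6 * k * real ((2 * Q)\<^sup>2)"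
    unfolding V_def by (intro add_mono edge sum_mono) (auto intro!: smooth simp del: One_nat_def)
  also have "(\<Sum>(q, a)\<in>?F. 3 * k * s) = real (card ?F) * (3 * k * s)"
    by simp
  also have "\<dots> \<le> 2 * (real Q)\<^sup>2 * (3 * k * s)"
    using card k s1 by (intro mult_right_mono) auto
  also have "6 * k * real ((2 * Q)\<^sup>2) \<le> 6 * k * real ((2 * Q)\<^sup>2) * s"
    using k s1 mult_left_mono[of 1 s "6 * k * real ((2 * Q)\<^sup>2)"] by simp
  finally show ?thesis by (simp add: s_def power_mult_distrib algebra_simps)
qed

lemma sum_half_powers_le: "(\<Sum>j\<in>{m..<n}. (1/2::real) ^ j) \<le> 2 * (1/2) ^ m"
proof (cases "m \<le> n")
  case True
  then have "(\<Sum>j\<in>{m..<n}. (1/2::real) ^ j) = 2 * (1/2) ^ m - 2 * (1/2) ^ n"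
    by (induction n rule: dec_induct) auto
  then show ?thesis by simp
qed simp

text \<open>Up to constants, the block at Q costs N^(3/8) Q^(1/4) for Q <= sqrt N and N/Q beyond.
  Both are geometric in the dyadic index and largest near sqrt N, so the summation loses no
  logarithm.\<close>

lemma integral_norm_divisor_sum_le:
  "\<exists>C>0. \<forall>N\<ge>1. integral {0..1} (\<lambda>\<alpha>. norm (\<Sum>n\<in>{1..N}. of_nat (divisor_count n) * expo (real n * \<alpha>)))
    \<le> C * sqrt (real N)"
proof -
  define r :: real where "r = 2 powr (1/4)"
  define C where "C = 2 * (30 * zeta54 * (r / (r - 1)) + 120)"
  have r: "r > 1" unfolding r_def using powr_less_mono[of 0 "1/4" "2::real"] by simp
  have z: "zeta54 \<ge> 1" by (rule zeta54_ge_1)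
  show ?thesis
  proof (intro exI[of _ C] conjI allI impI)
    show "C > 0" unfolding C_def using r z by (intro mult_pos_pos add_nonneg_pos) auto
    fix N :: nat assume N: "N \<ge> 1"
    define B where "B = (\<lambda>j. {q \<in> {1..N}. floor_log q = j})"
    define T where "T = (\<lambda>j \<alpha>. \<Sum>n\<in>{1..N}. (\<Sum>q\<in>B j. of_real (kap N q n) *
      (\<Sum>a\<in>reduced_residues q. expo (real n * (real a / real q)))) * expo (real n * \<alpha>))"
    have contT: "continuous_on A (T j)" for A j unfolding T_def by (intro continuous_intros)
    \<comment> \<open>2^J is the largest power of two not exceeding sqrt N, where the two regimes
      meet.\<close>
    obtain J where J: "4 ^ J \<le> N" "N < 4 ^ (J + 1)"
      using ex_power_ivl1[of 4 N] N by auto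
    have Bsub: "B j \<subseteq> {2 ^ j..<2 * 2 ^ j}" for j
    proof
      fix q assume "q \<in> B j"
      then have "q > 0" "floor_log q = j" by (auto simp: B_def)
      then show "q \<in> {2 ^ j..<2 * 2 ^ j}"
        using floor_log_exp2_le[of q] floor_log_exp2_gt[of q] by auto
    qed
    have low: "integral {0..1} (\<lambda>\<alpha>. norm (T j \<alpha>)) \<le> 30 * zeta54 * real N powr (3/8) * r ^ j" if j: "j \<le> J" for j
    proof -
      define Q where "Q = (2::nat) ^ j"
      have QN: "Q\<^sup>2 \<le> N"
      proof -
        have "Q\<^sup>2 = 4 ^ j" by (simp add: Q_def power2_eq_square flip: power_mult_distrib)
        also have "\<dots> \<le> 4 ^ J" using j by (intro power_increasing) auto
        finally show ?thesis using J by simp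
      qed
      have Q1: "Q \<ge> 1" by (simp add: Q_def)
      then have Q2: "Q\<^sup>2 \<ge> 1" by simp
      define k where "k = zeta54 * real N powr (1/8) * real Q powr (- (5/4))"
      have k0: "k > 0" using z N Q1 by (simp add: k_def)
      have Qp: "(real Q)\<^sup>2 = real Q powr 2" using Q1 by simp
      have "real Q powr (1/4) = (real (Q\<^sup>2)) powr (1/8)"
        unfolding of_nat_power Qp powr_powr by simp
      also have "\<dots> \<le> real N powr (1/8)"
        using QN by (intro powr_mono2) auto
      finally have QN': "real Q powr (1/4) \<le> real N powr (1/8)" .
      have "integral {0..1} (\<lambda>\<alpha>. norm (T j \<alpha>)) \<le> 30 * k * (real Q)\<^sup>2 * sqrt (sqrt (real N / real (Q\<^sup>2)))"
        unfolding T_def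
      proof (rule integral_norm_block_le)
        show "B j \<subseteq> {Q..<2 * Q}" using Bsub by (simp add: Q_def)
        show "kap N q N \<le> k" if "q \<in> B j" for q
        proof -
          have q: "Q \<le> q" "q > 0" using that Bsub[of j] by (auto simp: Q_def B_def)
          have "kap N q N \<le> zeta54 * real N powr (1/8) * real q powr (- (5/4))"
            by (rule kap_le_powr[OF q(2)])
          also have "\<dots> \<le> k" unfolding k_def
            using q Q1 z by (intro mult_left_mono powr_mono2') auto
          finally show ?thesis .
        qed
        \<comment> \<open>For M = Q^2 the slope condition amounts to 1/Q <= k, which follows from
          Q^(1/4) <= N^(1/8) and \<open>zeta54\<close> >= 1.\<close>
        have "1 / real Q = real Q powr (1/4) * real Q powr (- (5/4))"
        proof -
          have "real Q powr (1/4) * real Q powr (- (5/4)) = real Q powr (-1)"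
            by (simp only: powr_add[symmetric]) simp
          also have "\<dots> = 1 / real Q" using Q1 by (simp add: powr_minus_divide)
          finally show ?thesis by (rule sym)
        qed
        also have "\<dots> \<le> real N powr (1/8) * real Q powr (- (5/4))"
          by (intro mult_right_mono QN') auto
        also have "\<dots> \<le> k"
          using mult_right_mono[OF z, of "real N powr (1/8) * real Q powr (- (5/4))"]
          by (simp add: k_def mult.assoc)
        finally have "1 / real Q / real (Q\<^sup>2) \<le> k / real (Q\<^sup>2)"
          by (intro divide_right_mono) auto
        then show "1 / (real Q)^3 \<le> k / real (Q\<^sup>2)"
          by (simp add: power2_eq_square power3_eq_cube mult.assoc)
      qed (use QN Q1 Q2 k0 in auto)
      also have "\<dots> = 30 * zeta54 * real N powr (3/8) * real Q powr (1/4)"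
      proof -
        have "sqrt (sqrt (real N / real (Q\<^sup>2))) = (real N / (real Q)\<^sup>2) powr (1/4)"
          by (simp add: powr_half_sqrt[symmetric] powr_powr)
        also have "\<dots> = real N powr (1/4) / (real Q powr (1/2))"
          unfolding powr_divide Qp powr_powr by simp
        finally have "30 * k * (real Q)\<^sup>2 * sqrt (sqrt (real N / real (Q\<^sup>2))) =
           30 * zeta54 * (real N powr (1/8) * real N powr (1/4)) * (real Q powr (- (5/4)) * real Q powr 2 * real Q powr (- (1/2)))"
          unfolding k_def Qp by (simp add: powr_minus_divide[of _ "1/2"])
        also have "real N powr (1/8) * real N powr (1/4) = real N powr (3/8)"
          by (simp only: powr_add[symmetric]) simp
        also have "real Q powr (- (5/4)) * real Q powr 2 * real Q powr (- (1/2)) = real Q powr (1/4)"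
          by (simp only: powr_add[symmetric]) simp
        finally show ?thesis .
      qed
      also have "real Q powr (1/4) = r ^ j"
        unfolding r_def Q_def by (simp add: powr_powr powr_realpow[symmetric] mult.commute)
      finally show ?thesis .
    qed
    \<comment> \<open>Beyond sqrt N a ramp of length Q^2 would no longer fit, so M = N: the fourth
      root becomes 1, and the cubic bound for \<open>kap\<close> provides the decay.\<close>
    have high: "integral {0..1} (\<lambda>\<alpha>. norm (T j \<alpha>)) \<le> 60 * real N * (1/2) ^ j" if j: "j \<ge> J + 1" for j
    proof -
      define Q where "Q = (2::nat) ^ j"
      have QN: "N \<le> Q\<^sup>2"
      proof -
        have "N \<le> 4 ^ (J + 1)" using J by simp
        also have "\<dots> \<le> 4 ^ j" using j by (intro power_increasing) auto
        also have "\<dots> = Q\<^sup>2" by (simp add: Q_def power2_eq_square flip: power_mult_distrib)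
        finally show ?thesis .
      qed
      have Q1: "Q \<ge> 1" by (simp add: Q_def)
      define k where "k = 2 * real N / (real Q)^3"
      have k0: "k > 0" using N Q1 by (simp add: k_def)
      have "integral {0..1} (\<lambda>\<alpha>. norm (T j \<alpha>)) \<le> 30 * k * (real Q)\<^sup>2 * sqrt (sqrt (real N / real N))"
        unfolding T_def
      proof (rule integral_norm_block_le)
        show "B j \<subseteq> {Q..<2 * Q}" using Bsub by (simp add: Q_def)
        show "kap N q N \<le> k" if "q \<in> B j" for q
        proof -
          have q: "Q \<le> q" "q > 0" using that Bsub[of j] by (auto simp: Q_def B_def)
          have "kap N q N \<le> 2 * real N / (real q)^3"
            by (rule kap_le_cube[OF q(2)])
          also have "\<dots> \<le> k" unfolding k_def
            using q Q1 by (intro divide_left_mono power_mono) auto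
          finally show ?thesis .
        qed
        show "1 / (real Q)^3 \<le> k / real N"
          unfolding k_def using N Q1 by (simp add: divide_right_mono)
      qed (use QN Q1 N k0 in auto)
      also have "\<dots> = 60 * real N / real Q"
        using N Q1 by (simp add: k_def power2_eq_square power3_eq_cube)
      also have "\<dots> = 60 * real N * (1/2) ^ j" by (simp add: Q_def power_divide)
      finally show ?thesis .
    qed
    \<comment> \<open>The factor 2 comes from the symmetrised divisor count. Dyadic indices up to N
      cover all q <= N because j < 2^j; the surplus blocks are empty.\<close>
    have S: "(\<Sum>n\<in>{1..N}. of_nat (divisor_count n) * expo (real n * \<alpha>)) = 2 * (\<Sum>j\<in>{..<N+1}. T j \<alpha>)" for \<alpha>
    proof -
      let ?g = "\<lambda>n q. of_real (kap N q n) * (\<Sum>a\<in>reduced_residues q. expo (real n * (real a / real q)))"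
      have "of_nat (divisor_count n) * expo (real n * \<alpha>) = (\<Sum>j\<in>{..<N+1}. 2 * ((\<Sum>q\<in>B j. ?g n q) * expo (real n * \<alpha>)))"
        if n: "n \<in> {1..N}" for n
      proof -
        have "floor_log q < N + 1" if "q \<in> {1..N}" for q
        proof -
          have "floor_log q < 2 ^ floor_log q" by (rule less_exp)
          also have "\<dots> \<le> q" using that by (intro floor_log_exp2_le) auto
          finally show ?thesis using that by simp
        qed
        then have "(\<Sum>j\<in>{..<N+1}. \<Sum>q\<in>B j. ?g n q) = (\<Sum>q\<in>{1..N}. ?g n q)"
          unfolding B_def by (intro sum.group) auto
        then have "of_nat (divisor_count n) = 2 * (\<Sum>j\<in>{..<N+1}. \<Sum>q\<in>B j. ?g n q)"
          using divisor_count_ramanujan[of n N] n by simp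
        then have "of_nat (divisor_count n) * expo (real n * \<alpha>) =
            2 * ((\<Sum>j\<in>{..<N+1}. \<Sum>q\<in>B j. ?g n q) * expo (real n * \<alpha>))"
          by (simp only: mult.assoc)
        also have "\<dots> = 2 * (\<Sum>j\<in>{..<N+1}. (\<Sum>q\<in>B j. ?g n q) * expo (real n * \<alpha>))"
          by (subst sum_distrib_right) (rule refl)
        finally show ?thesis by (subst sum_distrib_left[symmetric])
      qed
      then have "(\<Sum>n\<in>{1..N}. of_nat (divisor_count n) * expo (real n * \<alpha>)) =
        (\<Sum>n\<in>{1..N}. \<Sum>j\<in>{..<N+1}. 2 * ((\<Sum>q\<in>B j. ?g n q) * expo (real n * \<alpha>)))"
        by (intro sum.cong refl) blast
      also have "\<dots> = (\<Sum>j\<in>{..<N+1}. 2 * T j \<alpha>)"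
        unfolding T_def by (subst sum.swap) (subst sum_distrib_left, rule refl)
      finally show ?thesis by (simp only: sum_distrib_left)
    qed
    have "integral {0..1} (\<lambda>\<alpha>. norm (\<Sum>n\<in>{1..N}. of_nat (divisor_count n) * expo (real n * \<alpha>)))
      \<le> integral {0..1} (\<lambda>\<alpha>. 2 * (\<Sum>j\<in>{..<N+1}. norm (T j \<alpha>)))"
      unfolding S
    proof (intro integral_le integrable_continuous_real)
      show "norm (2 * (\<Sum>j\<in>{..<N+1}. T j \<alpha>)) \<le> 2 * (\<Sum>j\<in>{..<N+1}. norm (T j \<alpha>))" for \<alpha>
        unfolding norm_mult by (simp only: norm_numeral) (intro mult_left_mono norm_sum, simp)
    qed (intro continuous_intros contT)+
    also have "\<dots> = 2 * (\<Sum>j\<in>{..<N+1}. integral {0..1} (\<lambda>\<alpha>. norm (T j \<alpha>)))"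
      unfolding integral_mult_right
      by (intro arg_cong[where f = "\<lambda>x. 2 * x"] integral_sum integrable_continuous_real continuous_intros contT) auto
    also have "(\<Sum>j\<in>{..<N+1}. integral {0..1} (\<lambda>\<alpha>. norm (T j \<alpha>))) \<le>
        (30 * zeta54 * (r / (r - 1)) + 120) * sqrt (real N)"
    proof -
      have "J < 4 ^ J" by (rule less_exp[THEN less_le_trans]) (intro power_mono, auto)
      then have JN: "J < N" using J by simp
      then have split: "{..<N+1} = {..<J+1} \<union> {J+1..<N+1}" by auto
      have rJ: "r ^ J \<le> real N powr (1/8)"
      proof -
        have "r ^ J = (real (4 ^ J)) powr (1/8)"
        proof -
          have "real (4 ^ J) = 2 powr (2 * real J)"
            by (simp add: powr_powr[symmetric] powr_realpow)
          then show ?thesis unfolding r_def by (simp add: powr_powr powr_realpow[symmetric] mult.commute)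
        qed
        also have "\<dots> \<le> real N powr (1/8)" using J by (intro powr_mono2) auto
        finally show ?thesis .
      qed
      have "(\<Sum>j\<in>{..<J+1}. integral {0..1} (\<lambda>\<alpha>. norm (T j \<alpha>))) \<le> (\<Sum>j\<in>{..<J+1}. 30 * zeta54 * real N powr (3/8) * r ^ j)"
        by (intro sum_mono low) auto
      also have "\<dots> = 30 * zeta54 * real N powr (3/8) * ((r ^ (J + 1) - 1) / (r - 1))"
        using r geometric_sum[of r "J + 1"] by (simp flip: sum_distrib_left)
      also have "\<dots> \<le> 30 * zeta54 * real N powr (3/8) * (r * real N powr (1/8) / (r - 1))"
        using r z rJ by (intro mult_left_mono divide_right_mono)
          (auto intro: order_trans[of _ "r * r ^ J"])
      also have "\<dots> = 30 * zeta54 * (r / (r - 1)) * (real N powr (3/8) * real N powr (1/8))"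
        by simp
      also have "real N powr (3/8) * real N powr (1/8) = sqrt (real N)"
        by (simp only: powr_add[symmetric]) (simp add: powr_half_sqrt)
      finally have 1: "(\<Sum>j\<in>{..<J+1}. integral {0..1} (\<lambda>\<alpha>. norm (T j \<alpha>))) \<le> 30 * zeta54 * (r / (r - 1)) * sqrt (real N)" .
      have "(\<Sum>j\<in>{J+1..<N+1}. integral {0..1} (\<lambda>\<alpha>. norm (T j \<alpha>))) \<le> (\<Sum>j\<in>{J+1..<N+1}. 60 * real N * (1/2) ^ j)"
        by (intro sum_mono high) auto
      also have "\<dots> = 60 * real N * (\<Sum>j\<in>{J+1..<N+1}. (1/2) ^ j)"
        by (simp only: sum_distrib_left)
      also have "\<dots> \<le> 60 * real N * (2 * (1/2) ^ (J + 1))"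
        by (intro mult_left_mono sum_half_powers_le) auto
      also have "\<dots> = 120 * (real N / 2 ^ (J + 1))"
        by (simp add: power_one_over)
      also have "real N / 2 ^ (J + 1) \<le> sqrt (real N)"
      proof -
        have "real N \<le> real (4 ^ (J + 1))" using J by (simp only: of_nat_le_iff less_imp_le)
        also have "\<dots> = (2 ^ (J + 1))\<^sup>2" by (simp add: power2_eq_square flip: power_mult_distrib)
        finally have "sqrt (real N) \<le> 2 ^ (J + 1)" by (intro real_le_lsqrt) auto
        then have "sqrt (real N) * sqrt (real N) \<le> sqrt (real N) * 2 ^ (J + 1)"
          by (intro mult_left_mono) auto
        then show ?thesis by (simp add: divide_le_eq)
      qed
      finally have 2: "(\<Sum>j\<in>{J+1..<N+1}. integral {0..1} (\<lambda>\<alpha>. norm (T j \<alpha>))) \<le> 120 * sqrt (real N)" by simp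
      show ?thesis unfolding split using 1 2 by (subst sum.union_disjoint) (auto simp: distrib_right)
    qed
    finally show "integral {0..1} (\<lambda>\<alpha>. norm (\<Sum>n\<in>{1..N}. of_nat (divisor_count n) * expo (real n * \<alpha>))) \<le> C * sqrt (real N)"
      by (simp only: C_def mult.assoc)
  qed
qed

section \<open>The lower bound\<close>

text \<open>A block of L consecutive integers starting at a multiple of L contains no other multiple
  of L. Replacing w on the block by its value there costs at most L times the variation inside the
  block, and the blocks are disjoint.\<close>

lemma sampling_error_le:
  fixes w :: "nat \<Rightarrow> real"
  assumes w: "w 0 = 0" "\<And>n. n \<ge> N \<Longrightarrow> w n = 0" and L: "L > 0"
  shows "\<bar>real L * (\<Sum>n | n \<in> {1..N} \<and> L dvd n. w n) - (\<Sum>n\<in>{1..N}. w n)\<bar>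
    \<le> real L * (\<Sum>n\<in>{1..N}. \<bar>w n - w (n - 1)\<bar>)"
proof -
  define D where "D = (\<lambda>n. \<bar>w n - w (n - 1)\<bar>)"
  define f where "f = (\<lambda>n. (if L dvd n then real L * w n else 0) - w n)"
  let ?I = "\<lambda>j. {j * L..<j * L + L}"
  have NL: "N \<le> N * L" using L by simp
  have path: "\<bar>w a - w b\<bar> \<le> sum D {a<..b}" if "a \<le> b" for a b
    using that
  proof (induction b rule: dec_induct)
    case (step b)
    then have "{a<..Suc b} = insert (Suc b) {a<..b}" by auto
    then show ?case using step by (auto simp: D_def)
  qed simp
  have block: "\<bar>sum f (?I j)\<bar> \<le> real L * sum D (?I j)" for j
  proof -
    have "{i \<in> ?I j. L dvd i} = {j * L}"
    proof (intro equalityI subsetI)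
      fix i assume "i \<in> {i \<in> ?I j. L dvd i}"
      then have i: "L dvd i" "j * L \<le> i" "i < j * L + L" by auto
      from i(1) obtain k where k: "i = L * k" ..
      have "L * j \<le> L * k" "L * k < L * Suc j" using i k by (simp_all add: mult.commute)
      then have "j \<le> k" "k < Suc j" using L by (simp_all only: mult_le_cancel1 mult_less_cancel1)
      then have "k = j" by simp
      then show "i \<in> {j * L}" using k by (simp add: mult.commute)
    qed (use L in auto)
    then have "(\<Sum>i\<in>?I j. if L dvd i then real L * w i else 0) = real L * w (j * L)"
      by (simp flip: sum.inter_filter)
    then have "sum f (?I j) = (\<Sum>i\<in>?I j. w (j * L) - w i)"
      by (simp add: f_def sum_subtractf)
    moreover have "\<bar>w (j * L) - w i\<bar> \<le> sum D (?I j)" if i: "i \<in> ?I j" for i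
    proof -
      have "\<bar>w (j * L) - w i\<bar> \<le> sum D {j * L<..i}"
        using i by (intro path) auto
      also have "\<dots> \<le> sum D (?I j)"
        using i by (intro sum_mono2) (auto simp: D_def)
      finally show ?thesis .
    qed
    ultimately have "\<bar>sum f (?I j)\<bar> \<le> (\<Sum>i\<in>?I j. sum D (?I j))"
      by (simp only:) (intro order_trans[OF sum_abs] sum_mono, blast)
    then show ?thesis by simp
  qed
  have "(\<Sum>n | n \<in> {1..N} \<and> L dvd n. w n) = (\<Sum>n\<in>{1..N}. if L dvd n then w n else 0)"
    by (rule sum.inter_filter) simp
  then have "real L * (\<Sum>n | n \<in> {1..N} \<and> L dvd n. w n) - (\<Sum>n\<in>{1..N}. w n) = sum f {1..N}"
    by (simp add: f_def sum_subtractf sum_distrib_left if_distrib[of "\<lambda>y. real L * y"] cong: if_cong)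
  \<comment> \<open>As w vanishes at 0 and from N on, the range can be changed to N complete blocks
    without altering the sum.\<close>
  also have "sum f {1..N} = sum f {..<N * L}"
  proof -
    have f0: "f n = 0" if "n = 0 \<or> n \<ge> N" for n using that w by (auto simp: f_def)
    have "sum f {1..N} = sum f {1..<N}"
      using f0 by (intro sum.mono_neutral_right) auto
    also have "\<dots> = sum f {..<N * L}"
      using f0 by (intro sum.mono_neutral_left) (auto simp: not_less intro: less_le_trans[OF _ NL])
    finally show ?thesis .
  qed
  also have "\<dots> = (\<Sum>j<N. sum f (?I j))" by (rule sum.nat_group[symmetric])
  also have "\<bar>\<dots>\<bar> \<le> (\<Sum>j<N. real L * sum D (?I j))"
    by (rule order_trans[OF sum_abs]) (intro sum_mono block)
  also have "\<dots> = real L * sum D {..<N * L}"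
    by (simp only: sum_distrib_left[symmetric] sum.nat_group)
  also have "sum D {..<N * L} \<le> sum D ({..<N * L} \<union> {1..N})"
    by (intro sum_mono2) (auto simp: D_def)
  also have "\<dots> = sum D {1..N}"
    using w by (intro sum.mono_neutral_right) (auto simp: D_def not_le)
  finally show ?thesis using L by (simp add: D_def mult_left_mono)
qed

section \<open>Chebyshev weights on the denominators\<close>

lemma card_multiples_Icc:
  assumes "e > 0"
  shows "card {q \<in> {1..X}. e dvd q} = X div e"
proof -
  have "{q \<in> {1..X}. e dvd q} = (\<lambda>k. e * k) ` {1..X div e}"
  proof (intro equalityI subsetI)
    fix q assume q: "q \<in> {q \<in> {1..X}. e dvd q}"
    then obtain k where k: "q = e * k" by auto
    then have "k \<le> X div e" using q assms by (simp add: less_eq_div_iff_mult_less_eq mult.commute)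
    moreover have "k \<ge> 1" using q k by (cases k) auto
    ultimately show "q \<in> (\<lambda>k. e * k) ` {1..X div e}" using k by auto
  next
    fix q assume "q \<in> (\<lambda>k. e * k) ` {1..X div e}"
    then obtain k where k: "q = e * k" "k \<in> {1..X div e}" by (elim imageE)
    then have "e * k \<le> X" using assms by (simp add: less_eq_div_iff_mult_less_eq mult.commute)
    then show "q \<in> {q \<in> {1..X}. e dvd q}" using k assms by auto
  qed
  then show ?thesis using assms by (simp add: card_image inj_on_def)
qed

lemma sum_divisor_sums:
  fixes g :: "nat \<Rightarrow> 'a :: comm_semiring_1"
  assumes "X \<le> Z"
  shows "(\<Sum>q\<in>{1..X}. \<Sum>e | e dvd q. g e) = (\<Sum>e\<in>{1..Z}. of_nat (X div e) * g e)"
proof -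
  have "(\<Sum>q\<in>{1..X}. \<Sum>e | e dvd q. g e) = (\<Sum>q\<in>{1..X}. \<Sum>e | e \<in> {1..Z} \<and> e dvd q. g e)"
  proof (intro sum.cong refl)
    fix q assume "q \<in> {1..X}"
    then show "{e. e dvd q} = {e. e \<in> {1..Z} \<and> e dvd q}"
      using assms by (auto dest: dvd_imp_le intro: Suc_leI dvd_pos_nat)
  qed
  also have "\<dots> = (\<Sum>e\<in>{1..Z}. \<Sum>q | q \<in> {1..X} \<and> e dvd q. g e)"
    by (rule sum.swap_restrict) auto
  also have "\<dots> = (\<Sum>e\<in>{1..Z}. of_nat (X div e) * g e)"
  proof (intro sum.cong refl)
    fix e assume "e \<in> {1..Z}"
    then have "e > 0" by simp
    from card_multiples_Icc[OF this, of X]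
    show "(\<Sum>q | q \<in> {1..X} \<and> e dvd q. g e) = of_nat (X div e) * g e" by simp
  qed
  finally show ?thesis .
qed

text \<open>A substitute for the indicator of coprimality: summing over all fractions $l/q$ with
$q \<le> 2Y$, and subtracting twice those with $q \<le> Y$, counts each reduced fraction 0 or 1 times,
so no Moebius inversion is needed.\<close>

definition chebyshev_weight :: "nat \<Rightarrow> nat \<Rightarrow> real" where
  "chebyshev_weight Y q = real (2 * Y div q) - 2 * real (Y div q)"

lemma chebyshev_weight_bounds: "0 \<le> chebyshev_weight Y q" "chebyshev_weight Y q \<le> 1"
proof -
  have "2 * (Y div q) \<le> 2 * Y div q \<and> 2 * Y div q \<le> 2 * (Y div q) + 1"
  proof (cases "q = 0")
    case False
    have "2 * (Y div q) * q \<le> 2 * Y" using div_times_less_eq_dividend[of Y q] by (simp add: mult.assoc)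
    moreover have "2 * Y < (2 * (Y div q) + 2) * q"
      using dividend_less_div_times[of q Y] False by (simp add: algebra_simps)
    ultimately show ?thesis
      using False less_mult_imp_div_less[of "2 * Y" "2 * (Y div q) + 2" q]
      by (simp add: less_eq_div_iff_mult_less_eq)
  qed simp
  then have "real (2 * (Y div q)) \<le> real (2 * Y div q)" "real (2 * Y div q) \<le> real (2 * (Y div q) + 1)"
    by (simp_all only: of_nat_le_iff)
  then show "0 \<le> chebyshev_weight Y q" "chebyshev_weight Y q \<le> 1"
    unfolding chebyshev_weight_def of_nat_add of_nat_mult of_nat_numeral of_nat_1 by linarith+
qed

lemma sum_chebyshev_weight:
  fixes g :: "nat \<Rightarrow> 'a :: real_normed_field"
  shows "(\<Sum>e\<in>{1..2 * Y}. of_real (chebyshev_weight Y e) * g e) =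
    (\<Sum>q\<in>{1..2 * Y}. \<Sum>e | e dvd q. g e) - 2 * (\<Sum>q\<in>{1..Y}. \<Sum>e | e dvd q. g e)"
proof -
  have "(\<Sum>q\<in>{1..Y}. \<Sum>e | e dvd q. g e) = (\<Sum>e\<in>{1..2 * Y}. of_nat (Y div e) * g e)"
    by (rule sum_divisor_sums) simp
  moreover have "(\<Sum>q\<in>{1..2 * Y}. \<Sum>e | e dvd q. g e) = (\<Sum>e\<in>{1..2 * Y}. of_nat (2 * Y div e) * g e)"
    by (rule sum_divisor_sums) simp
  ultimately show ?thesis
    by (simp add: chebyshev_weight_def sum_distrib_left left_diff_distrib sum_subtractf mult.assoc)
qed

text \<open>The totients over the divisors of q add up to q, so the total is Y(2Y + 1) - Y(Y + 1).
  It counts the reduced fractions that the weights retain, and it supplies the main term of the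
  lower bound.\<close>

lemma sum_totient_chebyshev_weight:
  "(\<Sum>e\<in>{1..2 * Y}. chebyshev_weight Y e * real (totient e)) = (real Y)\<^sup>2"
proof -
  have t: "(\<Sum>e | e dvd q. real (totient e)) = real q" for q
    using totient_divisor_sum[of q] by (simp flip: of_nat_sum)
  have g: "(\<Sum>q\<in>{1..X}. real q) = real X * (real X + 1) / 2" for X
    by (induction X) (auto simp: field_simps)
  show ?thesis
    using sum_chebyshev_weight[of Y "\<lambda>e. real (totient e)"]
    unfolding t g by (simp add: power2_eq_square field_simps)
qed

lemma has_integral_trig_fejer:
  fixes d :: "nat \<Rightarrow> complex"
  shows "((\<lambda>\<alpha>. (\<Sum>n\<in>{1..N}. d n * expo (real n * \<alpha>)) * of_real (fejer N (\<alpha> + x))) has_integral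
    (\<Sum>n\<in>{1..N}. d n * of_real (real N - real n) * expo (- (real n * x)))) {0..1}"
proof -
  let ?H = "{- int N<..<int N}"
  have "((\<lambda>\<alpha>. \<Sum>n\<in>{1..N}. \<Sum>h\<in>?H. (d n * of_int (int N - \<bar>h\<bar>) * expo (of_int h * x)) * expo (of_int (int n + h) * \<alpha>))
     has_integral (\<Sum>n\<in>{1..N}. \<Sum>h\<in>?H. (d n * of_int (int N - \<bar>h\<bar>) * expo (of_int h * x)) * (if int n + h = 0 then 1 else 0))) {0..1}"
    by (intro has_integral_sum has_integral_mult_right has_integral_expo) auto
  also have "(\<lambda>\<alpha>. \<Sum>n\<in>{1..N}. \<Sum>h\<in>?H. (d n * of_int (int N - \<bar>h\<bar>) * expo (of_int h * x)) * expo (of_int (int n + h) * \<alpha>)) =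
     (\<lambda>\<alpha>. (\<Sum>n\<in>{1..N}. d n * expo (real n * \<alpha>)) * of_real (fejer N (\<alpha> + x)))"
  proof
    fix \<alpha>
    have "expo (of_int (int n + h) * \<alpha>) = expo (real n * \<alpha>) * expo (of_int h * \<alpha>)" for n h
      by (simp add: expo_add[symmetric] distrib_right)
    moreover have "expo (of_int h * (\<alpha> + x)) = expo (of_int h * \<alpha>) * expo (of_int h * x)" for h
      by (simp add: expo_add[symmetric] distrib_left)
    ultimately show "(\<Sum>n\<in>{1..N}. \<Sum>h\<in>?H. (d n * of_int (int N - \<bar>h\<bar>) * expo (of_int h * x)) * expo (of_int (int n + h) * \<alpha>)) =
       (\<Sum>n\<in>{1..N}. d n * expo (real n * \<alpha>)) * of_real (fejer N (\<alpha> + x))"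
      unfolding fejer_expand sum_product by (intro sum.cong refl) (simp only: mult_ac)
  qed
  also have "(\<Sum>n\<in>{1..N}. \<Sum>h\<in>?H. (d n * of_int (int N - \<bar>h\<bar>) * expo (of_int h * x)) * (if int n + h = 0 then 1 else 0)) =
      (\<Sum>n\<in>{1..N}. d n * of_real (real N - real n) * expo (- (real n * x)))"
  proof (intro sum.cong refl)
    fix n assume n: "n \<in> {1..N}"
    have "(\<Sum>h\<in>?H. (d n * of_int (int N - \<bar>h\<bar>) * expo (of_int h * x)) * (if int n + h = 0 then 1 else 0)) =
      (\<Sum>h\<in>?H. if h = - int n then d n * of_int (int N - \<bar>- int n\<bar>) * expo (of_int (- int n) * x) else 0)"
      by (intro sum.cong refl) auto
    \<comment> \<open>For n = N the frequency -N lies outside the open range, in agreement with the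
      coefficient N - n = 0.\<close>
    also have "\<dots> = d n * of_real (real N - real n) * expo (- (real n * x))"
      using n by (subst sum.delta) auto
    finally show "(\<Sum>h\<in>?H. (d n * of_int (int N - \<bar>h\<bar>) * expo (of_int h * x)) * (if int n + h = 0 then 1 else 0)) =
      d n * of_real (real N - real n) * expo (- (real n * x))" .
  qed
  finally show ?thesis .
qed

section \<open>Divisor sums along multiples of q\<close>

lemma sum_inverse_square_plus_le:
  assumes N: "N \<ge> 1"
  shows "(\<Sum>m\<in>{1..N}. real N / ((real m)\<^sup>2 + real N)) \<le> 3 * sqrt (real N)"
proof -
  \<comment> \<open>Terms with m <= K are at most 1 and later ones at most N/m^2, so the two parts
    contribute at most sqrt N and N/K; the latter is at most 2 sqrt N because sqrt N < K + 1 <=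
    2K.\<close>
  define K where "K = floor_sqrt N"
  have K: "K\<^sup>2 \<le> N" "N < (Suc K)\<^sup>2" "K \<le> N"
    using floor_sqrt_power2_le Suc_floor_sqrt_power2_gt floor_sqrt_le by (auto simp: K_def)
  have K1: "K \<ge> 1" using N unfolding K_def by (simp add: Suc_leI)
  have Ks: "real K \<le> sqrt (real N)" using K(1) by (intro real_le_rsqrt) (simp flip: of_nat_power)
  have sK: "sqrt (real N) \<le> 2 * real K"
  proof (rule real_le_lsqrt)
    have "(Suc K)\<^sup>2 \<le> (2 * K)\<^sup>2" using K1 by (intro power_mono) auto
    then have "N \<le> (2 * K)\<^sup>2" using K by simp
    then show "real N \<le> (2 * real K)\<^sup>2" by (metis of_nat_le_iff of_nat_mult of_nat_numeral of_nat_power)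
  qed auto
  have tail: "(\<Sum>m\<in>{K+1..M}. 1 / (real m)\<^sup>2) \<le> 1 / real K - 1 / real M" if "K \<le> M" for M
    using that
  proof (induction M rule: dec_induct)
    case (step M)
    then have "M \<ge> 1" using K1 by simp
    then have "1 / (real (Suc M))\<^sup>2 \<le> 1 / real M - 1 / real (Suc M)"
      by (simp add: divide_simps) (simp add: power2_eq_square algebra_simps)
    then show ?case using step by simp
  qed simp
  have "(\<Sum>m\<in>{1..N}. real N / ((real m)\<^sup>2 + real N)) =
      (\<Sum>m\<in>{1..K}. real N / ((real m)\<^sup>2 + real N)) + (\<Sum>m\<in>{K+1..N}. real N / ((real m)\<^sup>2 + real N))"
    using K(3) by (subst sum.union_disjoint[symmetric]) (auto intro!: sum.cong)
  also have "(\<Sum>m\<in>{1..K}. real N / ((real m)\<^sup>2 + real N)) \<le> (\<Sum>m\<in>{1..K}. 1)"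
    using N by (intro sum_mono) (auto simp: divide_le_eq_1 add_nonneg_pos)
  also have "(\<Sum>m\<in>{K+1..N}. real N / ((real m)\<^sup>2 + real N)) \<le> (\<Sum>m\<in>{K+1..N}. real N * (1 / (real m)\<^sup>2))"
  proof (rule sum_mono)
    fix m assume "m \<in> {K+1..N}"
    then have "real N / ((real m)\<^sup>2 + real N) \<le> real N / (real m)\<^sup>2"
      by (intro divide_left_mono mult_pos_pos add_pos_nonneg) auto
    then show "real N / ((real m)\<^sup>2 + real N) \<le> real N * (1 / (real m)\<^sup>2)" by simp
  qed
  also have "\<dots> = real N * (\<Sum>m\<in>{K+1..N}. 1 / (real m)\<^sup>2)" by (simp only: sum_distrib_left)
  also have "\<dots> \<le> real N * (1 / real K)"
  proof (rule mult_left_mono)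
    have "0 \<le> 1 / real N" by simp
    then show "(\<Sum>m\<in>{K+1..N}. 1 / (real m)\<^sup>2) \<le> 1 / real K" using tail[OF K(3)] by linarith
  qed simp
  also have "\<dots> \<le> 2 * sqrt (real N)"
  proof -
    have "real N = sqrt (real N) * sqrt (real N)" by simp
    also have "\<dots> \<le> sqrt (real N) * (2 * real K)" using sK by (intro mult_left_mono) auto
    finally show ?thesis using K1 by (simp add: divide_le_eq mult_ac)
  qed
  finally show ?thesis using Ks by simp
qed

text \<open>The factor N - n is the Fejer coefficient, n / (m^2 + n) the symmetrising weight of the
  divisor m. Clipping at 0 gives the vanishing for all n >= N that \<open>sampling_error_le\<close>
  asks for.\<close>

definition hyp_weight :: "nat \<Rightarrow> nat \<Rightarrow> nat \<Rightarrow> real" where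
  "hyp_weight N m n = max 0 (real N - real n) * (real n / ((real m)\<^sup>2 + real n))"

lemma ratio_mono:
  assumes "m > 0" "n \<le> n'"
  shows "real n / ((real m)\<^sup>2 + real n) \<le> real n' / ((real m)\<^sup>2 + real n')"
proof -
  have "(real m)\<^sup>2 > 0" using assms by simp
  then have "(real m)\<^sup>2 + real n > 0" "(real m)\<^sup>2 + real n' > 0" by (simp_all add: add_pos_nonneg)
  moreover have "real n * (real m)\<^sup>2 \<le> real n' * (real m)\<^sup>2" using assms by (intro mult_right_mono) auto
  ultimately show ?thesis
    by (simp add: pos_divide_le_eq pos_le_divide_eq) (simp add: field_simps)
qed

text \<open>A step is (N - n) times an increment of the increasing ratio g, minus the previous value
  of g; either part contributes at most N g(N) in total. Keeping g(N) = N / (m^2 + N) instead of 1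
  matters, since its sum over m is only O(sqrt N).\<close>

lemma hyp_weight_variation:
  assumes m: "m > 0"
  shows "(\<Sum>n\<in>{1..N}. \<bar>hyp_weight N m n - hyp_weight N m (n - 1)\<bar>) \<le>
    2 * real N * (real N / ((real m)\<^sup>2 + real N))"
proof -
  define g where "g = (\<lambda>n. real n / ((real m)\<^sup>2 + real n))"
  have g_mono: "g n \<le> g n'" if "n \<le> n'" for n n' unfolding g_def by (rule ratio_mono[OF m that])
  have g0: "g n \<ge> 0" for n by (simp add: g_def)
  have "(\<Sum>n\<in>{1..N}. \<bar>hyp_weight N m n - hyp_weight N m (n - 1)\<bar>) \<le>
      (\<Sum>n\<in>{1..N}. real N * (g n - g (n - 1)) + g N)"
  proof (rule sum_mono)
    fix n assume n: "n \<in> {1..N}"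
    then have r: "real (n - 1) = real n - 1" by auto
    have "hyp_weight N m n - hyp_weight N m (n - 1) = (real N - real n) * (g n - g (n - 1)) - g (n - 1)"
    proof -
      have "hyp_weight N m n = (real N - real n) * g n"
        using n by (simp add: hyp_weight_def g_def)
      moreover have "hyp_weight N m (n - 1) = (real N - real n + 1) * g (n - 1)"
        using n unfolding hyp_weight_def g_def r by simp
      ultimately show ?thesis by (simp add: algebra_simps)
    qed
    moreover have "0 \<le> (real N - real n) * (g n - g (n - 1))"
      using n g_mono[of "n - 1" n] by (intro mult_nonneg_nonneg) auto
    moreover have "(real N - real n) * (g n - g (n - 1)) \<le> real N * (g n - g (n - 1))"
      using g_mono[of "n - 1" n] by (intro mult_right_mono) auto
    moreover have "g (n - 1) \<le> g N" using n by (intro g_mono) auto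
    ultimately show "\<bar>hyp_weight N m n - hyp_weight N m (n - 1)\<bar> \<le> real N * (g n - g (n - 1)) + g N"
      using g0[of "n - 1"] by linarith
  qed
  also have "\<dots> = real N * (\<Sum>n\<in>{1..N}. g n - g (n - 1)) + real N * g N"
    by (simp add: sum.distrib sum_distrib_left)
  also have "(\<Sum>n\<in>{1..N}. g n - g (n - 1)) = g N"
    by (subst sum_diff_telescope) (simp add: g_def)
  finally show ?thesis by (simp add: g_def)
qed

text \<open>For N/4 < n <= N/2 the first factor is at least N/2, and the ratio is at least 1/2
  because m^2 <= N/4 < n. At least N/8 such n exist.\<close>

lemma sum_hyp_weight_ge:
  assumes m: "m > 0" "4 * m\<^sup>2 \<le> N" and N: "N \<ge> 4"
  shows "(real N)\<^sup>2 / 32 \<le> (\<Sum>n\<in>{1..N}. hyp_weight N m n)"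
proof -
  have "(real N)\<^sup>2 / 32 = real N / 8 * (real N / 4)"
    by (simp add: power2_eq_square)
  also have "\<dots> \<le> real (card {N div 4 + 1..N div 2}) * (real N / 4)"
  proof (rule mult_right_mono)
    have "4 * (N div 4) \<le> N" "N \<le> 2 * (N div 2) + 1" by simp_all
    then have "N \<le> 8 * (N div 2 - N div 4)" using N by linarith
    then have "real N \<le> real (8 * (N div 2 - N div 4))" by (simp only: of_nat_le_iff)
    then show "real N / 8 \<le> real (card {N div 4 + 1..N div 2})" by simp
  qed simp
  also have "\<dots> = (\<Sum>n\<in>{N div 4 + 1..N div 2}. real N / 4)" by simp
  also have "\<dots> \<le> (\<Sum>n\<in>{N div 4 + 1..N div 2}. hyp_weight N m n)"
  proof (rule sum_mono)
    fix n assume "n \<in> {N div 4 + 1..N div 2}"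
    then have "N \<le> 4 * n" "2 * n \<le> N" by auto
    then have n: "m\<^sup>2 \<le> n" "real n \<le> real N / 2" "n > 0" using m N by auto
    have "real N / 2 * (1 / 2) \<le> max 0 (real N - real n) * (real n / ((real m)\<^sup>2 + real n))"
    proof (rule mult_mono)
      have "real (m\<^sup>2) \<le> real n" using n by (simp only: of_nat_le_iff)
      then have "(real m)\<^sup>2 \<le> real n" by simp
      then show "1 / 2 \<le> real n / ((real m)\<^sup>2 + real n)"
        using n by (simp add: divide_simps add_nonneg_pos)
    qed (use n in auto)
    then show "real N / 4 \<le> hyp_weight N m n" by (simp add: hyp_weight_def)
  qed
  also have "\<dots> \<le> (\<Sum>n\<in>{1..N}. hyp_weight N m n)"
    by (intro sum_mono2) (auto simp: hyp_weight_def)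
  finally show ?thesis .
qed

text \<open>The conditions m | n and q | n merge into lcm(m, q) | n, which leaves for each m a
  smooth weight sampled along one progression.\<close>

lemma sum_divisor_count_multiples:
  "(\<Sum>n\<in>{1..N}. real (divisor_count n) * (real N - real n) * (if q dvd n then real q else 0)) =
    2 * (\<Sum>m\<in>{1..N}. real q * (\<Sum>n | n \<in> {1..N} \<and> lcm m q dvd n. hyp_weight N m n))"
proof -
  have "(\<Sum>n\<in>{1..N}. real (divisor_count n) * (real N - real n) * (if q dvd n then real q else 0)) =
    (\<Sum>n\<in>{1..N}. \<Sum>m\<in>{1..N}. 2 * (real q * (if lcm m q dvd n then hyp_weight N m n else 0)))"
  proof (intro sum.cong refl)
    fix n assume n: "n \<in> {1..N}"
    have "real (divisor_count n) = 2 * (\<Sum>m\<in>{1..N}. if m dvd n then real n / ((real m)\<^sup>2 + real n) else 0)"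
      unfolding sum.inter_filter[OF finite_atLeastAtMost, symmetric]
      by (rule divisor_count_hyperbola) (use n in auto)
    then have "real (divisor_count n) * (real N - real n) * (if q dvd n then real q else 0) =
      (\<Sum>m\<in>{1..N}. 2 * (if m dvd n then real n / ((real m)\<^sup>2 + real n) else 0) * (real N - real n) * (if q dvd n then real q else 0))"
      by (simp only: sum_distrib_left sum_distrib_right)
    also have "\<dots> = (\<Sum>m\<in>{1..N}. 2 * (real q * (if lcm m q dvd n then hyp_weight N m n else 0)))"
      using n by (intro sum.cong refl) (auto simp: hyp_weight_def)
    finally show "real (divisor_count n) * (real N - real n) * (if q dvd n then real q else 0) =
      (\<Sum>m\<in>{1..N}. 2 * (real q * (if lcm m q dvd n then hyp_weight N m n else 0)))" .
  qed
  also have "\<dots> = (\<Sum>m\<in>{1..N}. \<Sum>n\<in>{1..N}. 2 * (real q * (if lcm m q dvd n then hyp_weight N m n else 0)))"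
    by (rule sum.swap)
  also have "\<dots> = 2 * (\<Sum>m\<in>{1..N}. real q * (\<Sum>n\<in>{1..N}. if lcm m q dvd n then hyp_weight N m n else 0))"
    by (simp only: sum_distrib_left)
  finally show ?thesis unfolding sum.inter_filter[OF finite_atLeastAtMost] .
qed

text \<open>Sampling along multiples of lcm(m, q) replaces \<open>a q m\<close> by gcd(q, m) W(m) /
  m with error q T(m). The signed gcd sums are nonnegative, so the main part may be cut down to m <=
  2Y, where it gives N^2 Y / 64; the errors sum to at most 36 Y^2 N^(3/2). Both are doubled by the
  symmetrised divisor count.\<close>

lemma sum_divisor_count_chebyshev_ge:
  assumes Y: "Y \<ge> 1" "16 * Y\<^sup>2 \<le> N"
  shows "(real N)\<^sup>2 * real Y / 32 - 72 * (real Y)\<^sup>2 * real N * sqrt (real N) \<le>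
    (\<Sum>n\<in>{1..N}. real (divisor_count n) * (real N - real n) *
      ((\<Sum>q\<in>{1..2 * Y}. if q dvd n then real q else 0) - 2 * (\<Sum>q\<in>{1..Y}. if q dvd n then real q else 0)))"
proof -
  define W where "W = (\<lambda>m. \<Sum>n\<in>{1..N}. hyp_weight N m n)"
  define T where "T = (\<lambda>m. 2 * real N * (real N / ((real m)\<^sup>2 + real N)))"
  define a where "a = (\<lambda>q m. real q * (\<Sum>n | n \<in> {1..N} \<and> lcm m q dvd n. hyp_weight N m n))"
  define \<Gamma> where "\<Gamma> = (\<lambda>m. (\<Sum>q\<in>{1..2 * Y}. real (gcd q m)) - 2 * (\<Sum>q\<in>{1..Y}. real (gcd q m)))"
  \<comment> \<open>The errors have unknown sign, hence the plus here against the minus in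
    \<open>\<Gamma>\<close>.\<close>
  define X where "X = (\<Sum>q\<in>{1..2 * Y}. real q) + 2 * (\<Sum>q\<in>{1..Y}. real q)"
  have N16: "N \<ge> 16" using Y by (metis le_trans mult.right_neutral mult_le_mono2 one_le_power)
  have W0: "W m \<ge> 0" for m unfolding W_def by (intro sum_nonneg) (auto simp: hyp_weight_def)
  have T0: "T m \<ge> 0" for m by (simp add: T_def)
  have g: "(\<Sum>q\<in>{1..Z}. real q) = real Z * (real Z + 1) / 2" for Z
    by (induction Z) (auto simp: field_simps)
  have X_le: "X \<le> 6 * (real Y)\<^sup>2"
    unfolding X_def g using Y by (simp add: power2_eq_square field_simps)
  have err: "\<bar>a q m - real (gcd q m) * (W m / real m)\<bar> \<le> real q * T m" if "q > 0" "m > 0" for q m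
  proof -
    let ?L = "lcm m q"
    have L: "?L > 0" using that by (simp add: lcm_pos_nat)
    have prod: "real (gcd q m) * real ?L = real q * real m"
      using prod_gcd_lcm_nat[of m q] by (metis gcd.commute mult.commute of_nat_mult)
    have c: "real q = real (gcd q m) / real m * real ?L"
      using prod that by (simp add: field_simps)
    let ?s = "\<Sum>n | n \<in> {1..N} \<and> ?L dvd n. hyp_weight N m n"
    have "a q m - real (gcd q m) * (W m / real m) = real (gcd q m) / real m * (real ?L * ?s - W m)"
      unfolding a_def by (subst c) (simp add: algebra_simps)
    then have "\<bar>a q m - real (gcd q m) * (W m / real m)\<bar> = real (gcd q m) / real m * \<bar>real ?L * ?s - W m\<bar>"
      by (simp add: abs_mult)
    also have "\<bar>real ?L * ?s - W m\<bar> \<le> real ?L * (\<Sum>n\<in>{1..N}. \<bar>hyp_weight N m n - hyp_weight N m (n - 1)\<bar>)"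
      unfolding W_def by (rule sampling_error_le) (use L in \<open>auto simp: hyp_weight_def\<close>)
    also have "\<dots> \<le> real ?L * T m"
      unfolding T_def by (intro mult_left_mono hyp_weight_variation that) auto
    finally have "\<bar>a q m - real (gcd q m) * (W m / real m)\<bar> \<le> real (gcd q m) / real m * (real ?L * T m)"
      by (simp add: mult_left_mono divide_right_mono)
    also have "\<dots> = real q * T m" using c by (simp only: mult.assoc[symmetric])
    finally show ?thesis .
  qed
  have "(\<Sum>n\<in>{1..N}. real (divisor_count n) * (real N - real n) *
      ((\<Sum>q\<in>{1..2 * Y}. if q dvd n then real q else 0) - 2 * (\<Sum>q\<in>{1..Y}. if q dvd n then real q else 0))) =
      (\<Sum>q\<in>{1..2 * Y}. 2 * (\<Sum>m\<in>{1..N}. a q m)) - 2 * (\<Sum>q\<in>{1..Y}. 2 * (\<Sum>m\<in>{1..N}. a q m))"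
  proof -
    have lin: "(\<Sum>n\<in>A. F n * (G n - 2 * H n)) = (\<Sum>n\<in>A. F n * G n) - 2 * (\<Sum>n\<in>A. F n * H n)"
      for A :: "nat set" and F G H :: "nat \<Rightarrow> real"
      by (simp add: sum_distrib_left right_diff_distrib sum_subtractf mult.left_commute)
    have sw: "(\<Sum>n\<in>{1..N}. real (divisor_count n) * (real N - real n) * (\<Sum>q\<in>{1..Z}. if q dvd n then real q else 0)) =
       (\<Sum>q\<in>{1..Z}. 2 * (\<Sum>m\<in>{1..N}. a q m))" for Z
    proof -
      have "(\<Sum>n\<in>{1..N}. real (divisor_count n) * (real N - real n) * (\<Sum>q\<in>{1..Z}. if q dvd n then real q else 0)) =
         (\<Sum>q\<in>{1..Z}. \<Sum>n\<in>{1..N}. real (divisor_count n) * (real N - real n) * (if q dvd n then real q else 0))"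
        unfolding sum_distrib_left by (rule sum.swap)
      then show ?thesis unfolding sum_divisor_count_multiples a_def .
    qed
    have "(\<Sum>n\<in>{1..N}. real (divisor_count n) * (real N - real n) *
      ((\<Sum>q\<in>{1..2 * Y}. if q dvd n then real q else 0) - 2 * (\<Sum>q\<in>{1..Y}. if q dvd n then real q else 0))) =
      (\<Sum>n\<in>{1..N}. real (divisor_count n) * (real N - real n) * (\<Sum>q\<in>{1..2 * Y}. if q dvd n then real q else 0)) -
      2 * (\<Sum>n\<in>{1..N}. real (divisor_count n) * (real N - real n) * (\<Sum>q\<in>{1..Y}. if q dvd n then real q else 0))"
      by (rule lin)
    then show ?thesis unfolding sw .
  qed
  also have "\<dots> = 2 * (\<Sum>m\<in>{1..N}. (\<Sum>q\<in>{1..2 * Y}. a q m) - 2 * (\<Sum>q\<in>{1..Y}. a q m))"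
  proof -
    have sw: "(\<Sum>q\<in>{1..Z}. 2 * (\<Sum>m\<in>{1..N}. a q m)) = 2 * (\<Sum>m\<in>{1..N}. \<Sum>q\<in>{1..Z}. a q m)" for Z
      unfolding sum_distrib_left[symmetric] by (subst sum.swap) (rule refl)
    show ?thesis unfolding sw by (simp add: sum_subtractf flip: sum_distrib_left)
  qed
  finally have Z: "(\<Sum>n\<in>{1..N}. real (divisor_count n) * (real N - real n) *
      ((\<Sum>q\<in>{1..2 * Y}. if q dvd n then real q else 0) - 2 * (\<Sum>q\<in>{1..Y}. if q dvd n then real q else 0))) =
      2 * (\<Sum>m\<in>{1..N}. (\<Sum>q\<in>{1..2 * Y}. a q m) - 2 * (\<Sum>q\<in>{1..Y}. a q m))" .
  have "(\<Sum>m\<in>{1..N}. \<Gamma> m * (W m / real m) - X * T m) \<le>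
      (\<Sum>m\<in>{1..N}. (\<Sum>q\<in>{1..2 * Y}. a q m) - 2 * (\<Sum>q\<in>{1..Y}. a q m))"
  proof (rule sum_mono)
    fix m assume m: "m \<in> {1..N}"
    have lo: "(\<Sum>q\<in>{1..2 * Y}. real (gcd q m) * (W m / real m) - real q * T m) \<le> (\<Sum>q\<in>{1..2 * Y}. a q m)"
    proof (rule sum_mono)
      fix q assume "q \<in> {1..2 * Y}"
      then show "real (gcd q m) * (W m / real m) - real q * T m \<le> a q m"
        using err[of q m] m unfolding abs_le_iff by simp
    qed
    have hi: "(\<Sum>q\<in>{1..Y}. a q m) \<le> (\<Sum>q\<in>{1..Y}. real (gcd q m) * (W m / real m) + real q * T m)"
    proof (rule sum_mono)
      fix q assume "q \<in> {1..Y}"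
      then show "a q m \<le> real (gcd q m) * (W m / real m) + real q * T m"
        using err[of q m] m unfolding abs_le_iff by simp
    qed
    have "\<Gamma> m * (W m / real m) - X * T m =
       (\<Sum>q\<in>{1..2 * Y}. real (gcd q m) * (W m / real m) - real q * T m) -
       2 * (\<Sum>q\<in>{1..Y}. real (gcd q m) * (W m / real m) + real q * T m)"
      unfolding sum_subtractf sum.distrib sum_distrib_right[symmetric] \<Gamma>_def X_def
      by (simp only: left_diff_distrib distrib_right distrib_left)
    then show "\<Gamma> m * (W m / real m) - X * T m \<le> (\<Sum>q\<in>{1..2 * Y}. a q m) - 2 * (\<Sum>q\<in>{1..Y}. a q m)"
      using lo hi by linarith
  qed
  moreover have "(\<Sum>m\<in>{1..N}. X * T m) \<le> 6 * (real Y)\<^sup>2 * (2 * real N * (3 * sqrt (real N)))"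
  proof -
    have "(\<Sum>m\<in>{1..N}. X * T m) \<le> (\<Sum>m\<in>{1..N}. 6 * (real Y)\<^sup>2 * T m)"
      by (intro sum_mono mult_right_mono X_le T0)
    also have "\<dots> = 6 * (real Y)\<^sup>2 * (2 * real N * (\<Sum>m\<in>{1..N}. real N / ((real m)\<^sup>2 + real N)))"
      by (simp only: T_def sum_distrib_left)
    also have "\<dots> \<le> 6 * (real Y)\<^sup>2 * (2 * real N * (3 * sqrt (real N)))"
      using N16 by (intro mult_left_mono sum_inverse_square_plus_le) auto
    finally show ?thesis .
  qed
  moreover have "(real N)\<^sup>2 / 32 / (2 * real Y) * (real Y)\<^sup>2 \<le> (\<Sum>m\<in>{1..N}. \<Gamma> m * (W m / real m))"
  proof -
    have YN: "2 * Y \<le> N"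
    proof -
      have "2 * Y \<le> 16 * Y\<^sup>2" using Y by (simp add: power2_eq_square)
      then show ?thesis using Y by simp
    qed
    \<comment> \<open>gcd(q, m) is the sum of the totients of the common divisors of q and m. This
      exhibits the difference \<open>\<Gamma> m\<close> as a sum of nonnegative terms.\<close>
    have \<Gamma>: "\<Gamma> m = (\<Sum>e\<in>{1..2 * Y}. chebyshev_weight Y e * (if e dvd m then real (totient e) else 0))"
      if "m > 0" for m
    proof -
      have "real (gcd q m) = (\<Sum>e | e dvd q. if e dvd m then real (totient e) else 0)" if "q > 0" for q
      proof -
        have "real (gcd q m) = (\<Sum>e | e dvd gcd q m. real (totient e))"
          using totient_divisor_sum[of "gcd q m"] by (simp flip: of_nat_sum)
        also have "{e. e dvd gcd q m} = {e \<in> {e. e dvd q}. e dvd m}" by auto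
        also have "(\<Sum>e\<in>\<dots>. real (totient e)) = (\<Sum>e | e dvd q. if e dvd m then real (totient e) else 0)"
          using that by (intro sum.inter_filter) simp
        finally show ?thesis .
      qed
      then show ?thesis
        using sum_chebyshev_weight[of Y "\<lambda>e. if e dvd m then real (totient e) else 0"]
        by (simp add: \<Gamma>_def)
    qed
    have "(real N)\<^sup>2 / 32 / (2 * real Y) * (real Y)\<^sup>2 =
        (\<Sum>m\<in>{1..2 * Y}. (real N)\<^sup>2 / 32 / (2 * real Y) * (chebyshev_weight Y m * real (totient m)))"
      by (simp only: sum_totient_chebyshev_weight[symmetric] sum_distrib_left)
    \<comment> \<open>Only the term e = m of \<open>\<Gamma> m\<close> is kept. The assumption 16
      Y^2 <= N gives 4 m^2 <= N for all m <= 2Y, and 1/m is at least 1/(2Y).\<close>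
    also have "\<dots> \<le> (\<Sum>m\<in>{1..2 * Y}. \<Gamma> m * (W m / real m))"
    proof (rule sum_mono)
      fix m assume m: "m \<in> {1..2 * Y}"
      then have m0: "m > 0" by simp
      have "m\<^sup>2 \<le> (2 * Y)\<^sup>2" using m by (intro power_mono) auto
      then have "4 * m\<^sup>2 \<le> N" using Y by (simp add: power_mult_distrib)
      then have "(real N)\<^sup>2 / 32 \<le> W m"
        unfolding W_def using m N16 by (intro sum_hyp_weight_ge) auto
      then have Wm: "(real N)\<^sup>2 / 32 / (2 * real Y) \<le> W m / real m"
        using m W0[of m] by (intro frac_le) auto
      have "chebyshev_weight Y m * (if m dvd m then real (totient m) else 0) \<le> \<Gamma> m"
        unfolding \<Gamma>[OF m0] by (rule member_le_sum[OF m]) (auto simp: chebyshev_weight_bounds)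
      then have "chebyshev_weight Y m * real (totient m) \<le> \<Gamma> m" by simp
      moreover have "0 \<le> chebyshev_weight Y m * real (totient m)"
        using chebyshev_weight_bounds(1) by simp
      ultimately have "(real N)\<^sup>2 / 32 / (2 * real Y) * (chebyshev_weight Y m * real (totient m)) \<le> W m / real m * \<Gamma> m"
        using Wm W0[of m] by (intro mult_mono) auto
      then show "(real N)\<^sup>2 / 32 / (2 * real Y) * (chebyshev_weight Y m * real (totient m)) \<le> \<Gamma> m * (W m / real m)"
        by (simp only: mult.commute)
    qed
    also have "\<dots> \<le> (\<Sum>m\<in>{1..N}. \<Gamma> m * (W m / real m))"
    proof (rule sum_mono2)
      fix m assume "m \<in> {1..N} - {1..2 * Y}"
      then have "\<Gamma> m \<ge> 0" using chebyshev_weight_bounds(1) by (subst \<Gamma>) (auto intro!: sum_nonneg)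
      then show "0 \<le> \<Gamma> m * (W m / real m)" using W0[of m] by simp
    qed (use YN in auto)
    finally show ?thesis .
  qed
  moreover have "(real N)\<^sup>2 / 32 / (2 * real Y) * (real Y)\<^sup>2 = (real N)\<^sup>2 * real Y / 64"
    using Y by (simp add: power2_eq_square)
  ultimately have "(real N)\<^sup>2 * real Y / 64 - 6 * (real Y)\<^sup>2 * (2 * real N * (3 * sqrt (real N))) \<le>
      (\<Sum>m\<in>{1..N}. (\<Sum>q\<in>{1..2 * Y}. a q m) - 2 * (\<Sum>q\<in>{1..Y}. a q m))"
    unfolding sum_subtractf by linarith
  then have "2 * ((real N)\<^sup>2 * real Y / 64 - 6 * (real Y)\<^sup>2 * (2 * real N * (3 * sqrt (real N)))) \<le>
      2 * (\<Sum>m\<in>{1..N}. (\<Sum>q\<in>{1..2 * Y}. a q m) - 2 * (\<Sum>q\<in>{1..Y}. a q m))"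
    by (rule mult_left_mono) simp
  then show ?thesis unfolding Z by (simp add: algebra_simps)
qed

section \<open>Pairing the exponential sum with Fejer kernels\<close>

lemma norm_has_integral_le:
  fixes f :: "real \<Rightarrow> complex"
  assumes f: "(f has_integral I) {0..1}" and g: "g integrable_on {0..1}"
    and le: "\<And>\<alpha>. norm (f \<alpha>) \<le> g \<alpha>"
  shows "norm I \<le> integral {0..1} g"
  using integral_norm_bound_integral[OF has_integral_integrable[OF f] g] le integral_unique[OF f] by simp

text \<open>The Ramanujan sums c_e(n) over e | q add up to the complete sum over l/q, which is q or
  0 according to whether q divides n. This is how the test function detects multiples of q.\<close>

lemma sum_chebyshev_ramanujan:
  "(\<Sum>q\<in>{1..2 * Y}. complex_of_real (chebyshev_weight Y q) * (\<Sum>a\<in>reduced_residues q. expo (real n * (real a / real q)))) =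
    of_real ((\<Sum>q\<in>{1..2 * Y}. if q dvd n then real q else 0) - 2 * (\<Sum>q\<in>{1..Y}. if q dvd n then real q else 0))"
proof -
  have *: "(\<Sum>q\<in>{1..X}. \<Sum>e | e dvd q. \<Sum>a\<in>reduced_residues e. expo (real n * (real a / real e))) =
      complex_of_real (\<Sum>q\<in>{1..X}. if q dvd n then real q else 0)" for X
    unfolding of_real_sum
  proof (intro sum.cong refl)
    fix q assume "q \<in> {1..X}"
    then have q: "q > 0" by simp
    show "(\<Sum>e | e dvd q. \<Sum>a\<in>reduced_residues e. expo (real n * (real a / real e))) =
        complex_of_real (if q dvd n then real q else 0)"
      by (subst sum_fractions[OF q, of "\<lambda>x. expo (real n * x)", symmetric], subst sum_expo_complete[OF q]) simp
  qed
  show ?thesis unfolding sum_chebyshev_weight * by simp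
qed

lemma sum_le_integral_norm_divisor_sum:
  assumes Y: "Y \<ge> 1" "16 * Y\<^sup>2 \<le> N"
  shows "(\<Sum>n\<in>{1..N}. real (divisor_count n) * (real N - real n) *
      ((\<Sum>q\<in>{1..2 * Y}. if q dvd n then real q else 0) - 2 * (\<Sum>q\<in>{1..Y}. if q dvd n then real q else 0)))
    \<le> 3 * (real N)\<^sup>2 * integral {0..1} (\<lambda>\<alpha>. norm (\<Sum>n\<in>{1..N}. of_nat (divisor_count n) * expo (real n * \<alpha>)))"
    (is "?Z \<le> _")
proof -
  let ?Q = "{1..2 * Y}"
  define D where "D = (\<lambda>\<alpha>. \<Sum>n\<in>{1..N}. of_nat (divisor_count n) * expo (real n * \<alpha>))"
  define V where "V = (\<lambda>\<alpha>. \<Sum>q\<in>?Q. \<Sum>a\<in>reduced_residues q. chebyshev_weight Y q * fejer N (\<alpha> + real a / real q))"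
  define I where "I = (\<Sum>q\<in>?Q. \<Sum>a\<in>reduced_residues q. complex_of_real (chebyshev_weight Y q) *
     (\<Sum>n\<in>{1..N}. of_nat (divisor_count n) * of_real (real N - real n) * expo (- (real n * (real a / real q)))))"
  have contD: "continuous_on A D" for A unfolding D_def by (intro continuous_intros)
  have "((\<lambda>\<alpha>. \<Sum>q\<in>?Q. \<Sum>a\<in>reduced_residues q. complex_of_real (chebyshev_weight Y q) * (D \<alpha> * of_real (fejer N (\<alpha> + real a / real q))))
      has_integral I) {0..1}"
    unfolding I_def D_def by (intro has_integral_sum has_integral_mult_right has_integral_trig_fejer) auto
  also have "(\<lambda>\<alpha>. \<Sum>q\<in>?Q. \<Sum>a\<in>reduced_residues q. complex_of_real (chebyshev_weight Y q) * (D \<alpha> * of_real (fejer N (\<alpha> + real a / real q)))) =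
      (\<lambda>\<alpha>. D \<alpha> * of_real (V \<alpha>))"
    unfolding V_def of_real_sum sum_distrib_left of_real_mult by (simp only: mult.left_commute)
  finally have int: "((\<lambda>\<alpha>. D \<alpha> * of_real (V \<alpha>)) has_integral I) {0..1}" .
  have V0: "0 \<le> V \<alpha>" for \<alpha>
    unfolding V_def by (intro sum_nonneg mult_nonneg_nonneg chebyshev_weight_bounds fejer_nonneg)
  \<comment> \<open>Weights at most 1 permit comparison with all reduced fractions of denominator up
    to 2Y, and (2Y)^2 <= N is the condition of the spacing bound.\<close>
  have V1: "V \<alpha> \<le> 3 * (real N)\<^sup>2" for \<alpha>
  proof -
    have "V \<alpha> \<le> (\<Sum>q\<in>?Q. \<Sum>a\<in>reduced_residues q. fejer N (\<alpha> + real a / real q))"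
      unfolding V_def
      by (intro sum_mono mult_left_le_one_le chebyshev_weight_bounds fejer_nonneg)
    also have "\<dots> = (\<Sum>(q, a)\<in>(SIGMA q:?Q. reduced_residues q). fejer N (\<alpha> + real a / real q))"
      by (rule sum.Sigma) auto
    also have "\<dots> \<le> 3 * (real N)\<^sup>2"
      using Y by (intro sum_fejer_farey_le) (auto simp: power_mult_distrib)
    finally show ?thesis .
  qed
  \<comment> \<open>Conjugation leaves the norm alone and turns e(-na/q) into e(na/q), the form in
    which the Ramanujan sums were evaluated.\<close>
  have "cnj I = (\<Sum>q\<in>?Q. \<Sum>a\<in>reduced_residues q. \<Sum>n\<in>{1..N}. of_real (real (divisor_count n) * (real N - real n)) *
      (of_real (chebyshev_weight Y q) * expo (real n * (real a / real q))))"
    unfolding I_def cnj_sum complex_cnj_mult cnj_expo sum_distrib_left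
    by (intro sum.cong refl) simp
  also have "\<dots> = (\<Sum>n\<in>{1..N}. of_real (real (divisor_count n) * (real N - real n)) *
      (\<Sum>q\<in>?Q. of_real (chebyshev_weight Y q) * (\<Sum>a\<in>reduced_residues q. expo (real n * (real a / real q)))))"
    unfolding sum_distrib_left by (subst sum.swap, subst (2) sum.swap) (rule refl)
  also have "\<dots> = of_real ?Z"
    unfolding sum_chebyshev_ramanujan by simp
  finally have cnj_I: "cnj I = of_real ?Z" .
  have "?Z \<le> \<bar>?Z\<bar>" by (rule abs_ge_self)
  also have "\<dots> = norm (cnj I)" unfolding cnj_I by (rule norm_of_real[symmetric])
  also have "\<dots> = norm I" by (rule complex_mod_cnj)
  also have "\<dots> \<le> integral {0..1} (\<lambda>\<alpha>. 3 * (real N)\<^sup>2 * norm (D \<alpha>))"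
  proof (rule norm_has_integral_le[OF int])
    show "norm (D \<alpha> * complex_of_real (V \<alpha>)) \<le> 3 * (real N)\<^sup>2 * norm (D \<alpha>)" for \<alpha>
      using V0[of \<alpha>] mult_right_mono[OF V1[of \<alpha>], of "norm (D \<alpha>)"] by (simp add: norm_mult mult.commute)
  qed (intro integrable_continuous_real continuous_intros contD)
  finally show ?thesis by (simp add: D_def)
qed

text \<open>The coefficient of e(\<alpha>) is d(1) = 1, and no Fourier coefficient exceeds the L1
  norm. This covers the small N, for which Y would round down to 0.\<close>

lemma integral_norm_divisor_sum_ge_1:
  assumes "N \<ge> 1"
  shows "1 \<le> integral {0..1} (\<lambda>\<alpha>. norm (\<Sum>n\<in>{1..N}. of_nat (divisor_count n) * expo (real n * \<alpha>)))"
proof -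
  define D where "D = (\<lambda>\<alpha>. \<Sum>n\<in>{1..N}. of_nat (divisor_count n) * expo (real n * \<alpha>))"
  have contD: "continuous_on A D" for A unfolding D_def by (intro continuous_intros)
  have "((\<lambda>\<alpha>. \<Sum>n\<in>{1..N}. of_nat (divisor_count n) * expo (of_int (int n - 1) * \<alpha>)) has_integral
     (\<Sum>n\<in>{1..N}. of_nat (divisor_count n) * (if int n - 1 = 0 then 1 else 0))) {0..1}"
    by (intro has_integral_sum has_integral_mult_right has_integral_expo) simp
  also have "(\<lambda>\<alpha>. \<Sum>n\<in>{1..N}. of_nat (divisor_count n) * expo (of_int (int n - 1) * \<alpha>)) = (\<lambda>\<alpha>. D \<alpha> * expo (- \<alpha>))"
    unfolding D_def sum_distrib_right
    by (intro ext sum.cong refl) (simp add: left_diff_distrib expo_add flip: expo_add)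
  also have "(\<Sum>n\<in>{1..N}. of_nat (divisor_count n) * (if int n - 1 = 0 then 1 else 0 :: complex)) = 
      (\<Sum>n\<in>{1..N}. if n = 1 then of_nat (divisor_count 1) else 0)"
    by (intro sum.cong refl) auto
  also have "\<dots> = 1" using assms by (simp add: divisor_count_def)
  finally have "norm (1::complex) \<le> integral {0..1} (\<lambda>\<alpha>. norm (D \<alpha>))"
    by (rule norm_has_integral_le) (auto simp: norm_mult intro!: integrable_continuous_real continuous_intros contD)
  then show ?thesis by (simp add: D_def)
qed

text \<open>With 4608 = 64 * 72, the bound Y <= sqrt N / 4608 makes the error 72 Y^2 N^(3/2) at most
  N^2 Y / 64, half of the main term. Division by 3 N^2 leaves Y / 192, and rounding down at most
  halves Y, whence 192 * 9216 = 1769472.\<close>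

lemma integral_norm_divisor_sum_ge:
  assumes N: "N \<ge> 1"
  shows "sqrt (real N) / 1769472 \<le>
    integral {0..1} (\<lambda>\<alpha>. norm (\<Sum>n\<in>{1..N}. of_nat (divisor_count n) * expo (real n * \<alpha>)))"
    (is "_ \<le> ?J")
proof (cases "sqrt (real N) < 4608")
  case True
  then show ?thesis using integral_norm_divisor_sum_ge_1[OF N] by linarith
next
  case False
  define s where "s = sqrt (real N)"
  define Y where "Y = nat \<lfloor>s / 4608\<rfloor>"
  have s: "s \<ge> 4608" "real N = s * s" using False by (auto simp: s_def)
  have "real Y = of_int \<lfloor>s / 4608\<rfloor>" unfolding Y_def using s by (intro of_nat_nat) simp
  then have Ys: "real Y \<le> s / 4608" "s / 4608 < real Y + 1" by linarith+
  have Y1: "Y \<ge> 1"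
  proof -
    have "real Y > 0" using Ys s by linarith
    then show ?thesis by simp
  qed
  have YN: "16 * Y\<^sup>2 \<le> N"
  proof -
    have "4 * real Y \<le> s" using Ys s by linarith
    then have "(4 * real Y) * (4 * real Y) \<le> s * s" by (intro mult_mono) auto
    then have "real (16 * Y\<^sup>2) \<le> real N" by (simp add: s(2) power2_eq_square)
    then show ?thesis by (simp only: of_nat_le_iff)
  qed
  have "72 * (real Y)\<^sup>2 * real N * s = 72 * real Y * (real Y * real N * s)"
    by (simp add: power2_eq_square)
  also have "\<dots> \<le> 72 * (s / 4608) * (real Y * real N * s)"
    using Ys s by (intro mult_right_mono mult_left_mono) auto
  also have "\<dots> = (real N)\<^sup>2 * real Y / 64"
    by (simp add: s(2) power2_eq_square)
  finally have "(real N)\<^sup>2 * real Y / 64 \<le> (real N)\<^sup>2 * real Y / 32 - 72 * (real Y)\<^sup>2 * real N * sqrt (real N)"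
    unfolding s_def by linarith
  also have "\<dots> \<le> 3 * (real N)\<^sup>2 * ?J"
    using sum_divisor_count_chebyshev_ge[OF Y1 YN] sum_le_integral_norm_divisor_sum[OF Y1 YN] by (rule order_trans)
  finally have "(real N)\<^sup>2 * (real Y / 192) \<le> (real N)\<^sup>2 * ?J" by linarith
  then have "real Y / 192 \<le> ?J" using N by (simp add: mult_le_cancel_left_pos del: One_nat_def)
  moreover have "s / 9216 \<le> real Y" using Ys Y1 by simp
  ultimately show ?thesis unfolding s_def by linarith
qed

theorem theorem1:
  shows "\<exists>c1 c2::real. 0 < c1 \<and> c1 < c2 \<and>
    (\<forall>x::real. x \<ge> 2 \<longrightarrow>
       c1 * sqrt x \<le> integral {0..1} (\<lambda>\<alpha>. norm (S_div x \<alpha>)) \<and>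
       integral {0..1} (\<lambda>\<alpha>. norm (S_div x \<alpha>)) \<le> c2 * sqrt x)"
proof -
  \<comment> \<open>Half of 1/1769472, because sqrt x <= 2 sqrt N for the integer part N of
    x.\<close>
  define c1 :: real where "c1 = 1 / 3538944"
  obtain C where C: "C > 0" "\<And>N. N \<ge> 1 \<Longrightarrow>
      integral {0..1} (\<lambda>\<alpha>. norm (\<Sum>n\<in>{1..N}. of_nat (divisor_count n) * expo (real n * \<alpha>))) \<le> C * sqrt (real N)"
    using integral_norm_divisor_sum_le by blast
  show ?thesis
  \<comment> \<open>Adding \<open>c1\<close> to \<open>C\<close> secures the strict inequality
    between the two constants.\<close>
  proof (rule exI[of _ c1], rule exI[of _ "C + c1"], intro conjI allI impI)
    fix x :: real assume x: "x \<ge> 2"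
    define N where "N = nat \<lfloor>x\<rfloor>"
    have S: "S_div x = (\<lambda>\<alpha>. \<Sum>n\<in>{1..N}. of_nat (divisor_count n) * expo (real n * \<alpha>))"
      by (simp add: S_div_def N_def fun_eq_iff)
    have "real N = of_int \<lfloor>x\<rfloor>" unfolding N_def using x by (intro of_nat_nat) simp
    then have Nx: "real N \<le> x" "x < real N + 1" by linarith+
    then have N: "N \<ge> 1" using x by linarith
    have "sqrt x \<le> sqrt (4 * real N)" using Nx N by (intro real_sqrt_le_mono) simp
    then have "sqrt x \<le> 2 * sqrt (real N)" by (simp add: real_sqrt_mult)
    then show "c1 * sqrt x \<le> integral {0..1} (\<lambda>\<alpha>. norm (S_div x \<alpha>))"
      using integral_norm_divisor_sum_ge[OF N] unfolding S c1_def by simp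
    have "C * sqrt (real N) \<le> (C + c1) * sqrt x"
      using C(1) Nx by (intro mult_mono) (auto simp: c1_def)
    then show "integral {0..1} (\<lambda>\<alpha>. norm (S_div x \<alpha>)) \<le> (C + c1) * sqrt x"
      using C(2)[OF N] unfolding S by simp
  qed (use C(1) in \<open>simp_all add: c1_def\<close>)
qed

end
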